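(* There is an absolute constant $\alpha>0$ and a randomized polynomial-time algorithm such that the following holds. Let $k\ge2$, let $H=(V,F)$ be a $k$-uniform $k$-partite hypergraph, and let $g,f:V\to\mathbb{Z}_{\ge0}$ be functions with $\alpha k^3\log|V|\le g(v)\le f(v)$ for all $v\in V$. Assume that there exists a subhypergraph $H''\subseteq H$ with $g(v)\le\deg_{H''}(v)\le f(v)$ for all $v\in V$. Then the algorithm computes a subhypergraph $H'\subseteq H$ such that, with probability at least $1-4/|V|^4$, $\frac{g(v)}{20k}\le\deg_{H'}(v)\le f(v)$ for all $v\in V$.
   Context: A hypergraph $H=(V,F)$ is $k$-uniform $k$-partite if $V$ is partitioned into $V_1,\dots,V_k$ and every hyperedge contains exactly one vertex from each $V_i$. A subhypergraph here is $(V,F')$ with $F'\subseteq F$, and $\deg_{H'}(v)$ is the number of hyperedges of $H'$ containing $v$. $\log$ is the natural logarithm. *)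

theory Defs
  imports
    "HOL-Probability.Probability"
    "HOL-Library.Log_Nat"
    "HOL-Computational_Algebra.Polynomial"
begin

section \<open>Hypergraphs\<close>

text \<open>Hypergraphs are finite and have no parallel hyperedges. The classes \<open>P 1, \<dots>, P k\<close> of the
  partition are indexed, so a class may be empty (which is only possible if there is no hyperedge).\<close>

definition uniform_partite :: "nat \<Rightarrow> 'v set \<Rightarrow> 'v set set \<Rightarrow> bool" where
  "uniform_partite k V F \<longleftrightarrow>
     finite V \<and> (\<forall>e\<in>F. e \<subseteq> V) \<and>
     (\<exists>P :: nat \<Rightarrow> 'v set.
        disjoint_family_on P {1..k} \<and> (\<Union>i\<in>{1..k}. P i) = V \<and>
        (\<forall>e\<in>F. \<forall>i\<in>{1..k}. card (e \<inter> P i) = 1))"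

definition degree_in :: "'v set set \<Rightarrow> 'v \<Rightarrow> nat" where
  "degree_in F v = card {e \<in> F. v \<in> e}"

section \<open>Randomized programs with logarithmic cost\<close>

text \<open>Algorithms are structured programs on a random access machine. The memory consists of banks
  \<open>s 0, s 1, \<dots>\<close>, each an infinite array of natural numbers. A program mentions only finitely many
  banks, but addresses inside a bank are computed at run time. The only source of randomness is a
  fair coin.\<close>

type_synonym memory = "nat \<Rightarrow> nat \<Rightarrow> nat"

datatype aexp =
    Num nat
  | Cell nat aexp
  | Add aexp aexp
  | Sub aexp aexp
  | Mul aexp aexp
  | Quot aexp aexp

datatype com =
    Skip
  | Store nat aexp aexp
  | Flip nat aexp
  | Seq com com
  | Cond aexp com com
  | While aexp com

fun aval :: "aexp \<Rightarrow> memory \<Rightarrow> nat" where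
  "aval (Num n) s = n"
| "aval (Cell x a) s = s x (aval a s)"
| "aval (Add a b) s = aval a s + aval b s"
| "aval (Sub a b) s = aval a s - aval b s"
| "aval (Mul a b) s = aval a s * aval b s"
| "aval (Quot a b) s = aval a s div aval b s"

text \<open>Number of binary digits, plus one so that handling the number 0 is not free.\<close>

definition len :: "nat \<Rightarrow> nat" where
  "len n = floorlog 2 n + 1"

text \<open>Logarithmic cost criterion: every number that occurs as an address, as an operand or as a
  result is charged with its length. This is polynomially related to Turing machine time.\<close>

fun acost :: "aexp \<Rightarrow> memory \<Rightarrow> nat" where
  "acost (Num n) s = len n"
| "acost (Cell x a) s = acost a s + len (aval (Cell x a) s)"
| "acost (Add a b) s = acost a s + acost b s + len (aval (Add a b) s)"
| "acost (Sub a b) s = acost a s + acost b s + len (aval (Sub a b) s)"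
| "acost (Mul a b) s = acost a s + acost b s + len (aval (Mul a b) s)"
| "acost (Quot a b) s = acost a s + acost b s + len (aval (Quot a b) s)"

definition store :: "memory \<Rightarrow> nat \<Rightarrow> nat \<Rightarrow> nat \<Rightarrow> memory" where
  "store s x i n = s(x := (s x)(i := n))"

definition add_cost :: "nat \<Rightarrow> (memory \<times> nat) pmf \<Rightarrow> (memory \<times> nat) pmf" where
  "add_cost t D = map_pmf (\<lambda>(s, u). (s, t + u)) D"

text \<open>\<open>exec c s D\<close>: started in memory \<open>s\<close>, program \<open>c\<close> halts for all outcomes of the coin flips, and
  \<open>D\<close> is the joint distribution of final memory and cost. Conditions hold iff their value is
  nonzero. The premises on \<open>E\<close> range over the support of \<open>D\<close>, so every continuation that can be
  reached has to halt.\<close>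

inductive exec :: "com \<Rightarrow> memory \<Rightarrow> (memory \<times> nat) pmf \<Rightarrow> bool" where
  Skip: "exec Skip s (return_pmf (s, 1))"
| Store: "exec (Store x a b) s
     (return_pmf (store s x (aval a s) (aval b s), 1 + acost a s + acost b s))"
| Flip: "exec (Flip x a) s
     (map_pmf (\<lambda>c. (store s x (aval a s) (of_bool c), 1 + acost a s)) (bernoulli_pmf (1/2)))"
| Seq: "\<lbrakk>exec c s D; \<And>s' t. (s', t) \<in> set_pmf D \<Longrightarrow> exec d s' (E s')\<rbrakk> \<Longrightarrow>
     exec (Seq c d) s (bind_pmf D (\<lambda>(s', t). add_cost t (E s')))"
| CondTrue: "\<lbrakk>aval a s \<noteq> 0; exec c s D\<rbrakk> \<Longrightarrow>
     exec (Cond a c d) s (add_cost (1 + acost a s) D)"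
| CondFalse: "\<lbrakk>aval a s = 0; exec d s D\<rbrakk> \<Longrightarrow>
     exec (Cond a c d) s (add_cost (1 + acost a s) D)"
| WhileFalse: "aval a s = 0 \<Longrightarrow> exec (While a c) s (return_pmf (s, 1 + acost a s))"
| WhileTrue: "\<lbrakk>aval a s \<noteq> 0; exec c s D;
      \<And>s' t. (s', t) \<in> set_pmf D \<Longrightarrow> exec (While a c) s' (E s')\<rbrakk> \<Longrightarrow>
     exec (While a c) s
       (add_cost (1 + acost a s) (bind_pmf D (\<lambda>(s', t). add_cost t (E s'))))"

inductive_cases exec_SkipE: "exec Skip s D"
inductive_cases exec_StoreE: "exec (Store x a b) s D"
inductive_cases exec_FlipE: "exec (Flip x a) s D"
inductive_cases exec_SeqE: "exec (Seq c d) s D"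
inductive_cases exec_CondE: "exec (Cond a c d) s D"
inductive_cases exec_WhileE: "exec (While a c) s D"

lemma exec_deterministic: "exec c s D \<Longrightarrow> exec c s D' \<Longrightarrow> D' = D"
proof (induction arbitrary: D' rule: exec.induct)
  case (Seq c s D d E)
  from Seq.prems show ?case
  proof (rule exec_SeqE)
    fix D2 E2
    assume D': "D' = bind_pmf D2 (\<lambda>(s', t). add_cost t (E2 s'))" and c: "exec c s D2"
      and d: "\<And>s' t. (s', t) \<in> set_pmf D2 \<Longrightarrow> exec d s' (E2 s')"
    have D2: "D2 = D" using c by (rule Seq.IH(1))
    have "E2 s' = E s'" if "(s', t) \<in> set_pmf D" for s' t
      using Seq.IH(2)[OF that] d that D2 by blast
    then show "D' = bind_pmf D (\<lambda>(s', t). add_cost t (E s'))"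
      unfolding D' D2 by (auto intro!: bind_pmf_cong)
  qed
next
  case (WhileTrue a s c D E)
  from WhileTrue.prems show ?case
  proof (rule exec_WhileE)
    fix D2 E2
    assume D': "D' = add_cost (Suc (acost a s)) (bind_pmf D2 (\<lambda>(s', t). add_cost t (E2 s')))"
      and c: "exec c s D2"
      and d: "\<And>s' t. (s', t) \<in> set_pmf D2 \<Longrightarrow> exec (While a c) s' (E2 s')"
    have D2: "D2 = D" using c by (rule WhileTrue.IH(1))
    have "E2 s' = E s'" if "(s', t) \<in> set_pmf D" for s' t
      using WhileTrue.IH(2)[OF that] d that D2 by blast
    then have "bind_pmf D2 (\<lambda>(s', t). add_cost t (E2 s')) =
        bind_pmf D (\<lambda>(s', t). add_cost t (E s'))"
      unfolding D2 by (auto intro!: bind_pmf_cong)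
    then show "D' = add_cost (1 + acost a s) (bind_pmf D (\<lambda>(s', t). add_cost t (E s')))"
      unfolding D' by simp
  qed (use WhileTrue.hyps in simp)
next
  case (Skip s)
  then show ?case by (rule exec_SkipE) simp
next
  case (Store x a b s)
  then show ?case by (rule exec_StoreE) simp
next
  case (Flip x a s)
  then show ?case by (rule exec_FlipE) simp
next
  case (CondTrue a s c D d)
  from CondTrue.prems CondTrue.hyps(1) CondTrue.IH show ?case
    by (elim exec_CondE) auto
next
  case (CondFalse a s d D c)
  from CondFalse.prems CondFalse.hyps(1) CondFalse.IH show ?case
    by (elim exec_CondE) auto
next
  case (WhileFalse a s c)
  from WhileFalse.prems show ?case
    by (rule exec_WhileE) (use WhileFalse.hyps in simp_all)
qed

text \<open>The input is written to bank 0; everything else is initially 0.\<close>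

definition init :: "nat list \<Rightarrow> memory" where
  "init xs = (\<lambda>x i. if x = 0 \<and> i < length xs then xs ! i else 0)"

definition input_size :: "nat list \<Rightarrow> nat" where
  "input_size xs = (\<Sum>x\<leftarrow>xs. len x)"

text \<open>The bound is a worst-case bound over the coin flips.\<close>

definition poly_time_on :: "nat list set \<Rightarrow> com \<Rightarrow> bool" where
  "poly_time_on I c \<longleftrightarrow>
     (\<exists>p :: nat poly. \<forall>xs\<in>I. \<exists>D. exec c (init xs) D \<and>
        (\<forall>(s, t)\<in>set_pmf D. t \<le> poly p (input_size xs)))"

section \<open>Instances as inputs\<close>

text \<open>Vertices are natural numbers. A hypergraph is presented by listing its vertices and its
  hyperedges, in any order and without repetitions.\<close>

definition lists_hypergraph ::
  "nat list \<Rightarrow> nat list list \<Rightarrow> nat set \<Rightarrow> nat set set \<Rightarrow> bool" where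
  "lists_hypergraph vs es V F \<longleftrightarrow>
     distinct vs \<and> set vs = V \<and>
     (\<forall>e\<in>set es. distinct e) \<and> distinct (map set es) \<and> set ` set es = F"

text \<open>All hyperedges of a \<open>k\<close>-uniform hypergraph have length \<open>k\<close>, so the code can be parsed
  from its first three entries. The partition into \<open>k\<close> classes is not part of the input.\<close>

definition encode ::
  "nat \<Rightarrow> nat list \<Rightarrow> nat list list \<Rightarrow> (nat \<Rightarrow> nat) \<Rightarrow> (nat \<Rightarrow> nat) \<Rightarrow> nat list" where
  "encode k vs es g f =
     [k, length vs, length es] @ vs @ map g vs @ map f vs @ concat es"

definition instances :: "nat list set" where
  "instances = {encode k vs es g f | k vs es g f V F.
     2 \<le> k \<and> uniform_partite k V F \<and> lists_hypergraph vs es V F}"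

text \<open>The output is read from bank 1, as the characteristic vector of a subset of the hyperedges.\<close>

definition selected :: "nat list list \<Rightarrow> memory \<Rightarrow> nat set set" where
  "selected es s = {set (es ! j) | j. j < length es \<and> s 1 j \<noteq> 0}"

end

theory Submission
  imports Defs
begin

text \<open>The algorithm is deterministic. It selects hyperedges one at a time, guided by two exponential
  potentials: with \<open>d v\<close> the number of selected hyperedges at \<open>v\<close> and \<open>G = min g\<close>,
  \<open>P = (\<Sum>v. (1 + G / (2 f v)) ^ d v)\<close> penalizes high degrees, and
  \<open>Q = (\<Sum>v. (1 - G / (2 g v)) ^ d v)\<close>, summed over the vertices with \<open>40 d v < g v\<close>, penalizes
  low ones. As long as \<open>Q \<noteq> 0\<close>, averaging over the unselected hyperedges of the feasible solution
  yields a hyperedge whose addition does not increase \<open>P Q\<^sup>3\<close>, so \<open>P Q\<^sup>3 \<le> |V|\<^sup>4\<close> throughout. An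
  unsaturated vertex forces \<open>Q \<ge> exp (- G / 40)\<close>, hence \<open>P \<le> |V|\<^sup>4 exp (3 G / 40)\<close>, whereas
  \<open>d v \<ge> f v\<close> would force \<open>P \<ge> exp (G / 8)\<close>; this is impossible for \<open>G > 80 ln |V|\<close>. When \<open>Q = 0\<close>,
  every degree is at least \<open>g / 40 \<ge> g / (20 k)\<close>. To stay within integers, the factors
  \<open>G / (2 f v)\<close> and \<open>G / (2 g v)\<close> are rounded down to multiples of \<open>1 / R\<close> and all weights are
  scaled by \<open>R ^ m\<close>.\<close>

section \<open>Loop programs and their cost\<close>

lemma len_le_iff: "len n \<le> w \<longleftrightarrow> 0 < w \<and> n < 2 ^ (w - 1)"
proof (cases w)
  case (Suc w')
  have "floorlog 2 n \<le> w' \<longleftrightarrow> n < 2 ^ w'"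
    by (simp add: floorlog_le_iff)
  then show ?thesis by (simp add: len_def Suc)
qed (simp add: len_def)

lemma less_two_power_len: "n < 2 ^ (len n - 1)"
  using len_le_iff[of n "len n"] by simp

lemma len_mono: "a \<le> b \<Longrightarrow> len a \<le> len b"
  by (simp add: len_def floorlog_mono)

lemma len_pos: "0 < len n"
  by (simp add: len_def)

lemma len_mult: "len (a * b) \<le> len a + len b"
proof -
  have "a * b < 2 ^ (len a - 1) * 2 ^ (len b - 1)"
    by (intro mult_strict_mono less_two_power_len) auto
  also have "\<dots> \<le> 2 ^ (len a + len b - 1)"
    unfolding power_add[symmetric] by (rule power_increasing) auto
  finally show ?thesis
    using len_pos[of a] by (simp add: len_le_iff)
qed

lemma len_add: "len (a + b) \<le> len a + len b"
proof -
  have "a < 2 ^ (len a + len b - 2)" "b < 2 ^ (len a + len b - 2)"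
    by (rule less_le_trans[OF less_two_power_len power_increasing]; use len_pos[of a] len_pos[of b] in simp)+
  then have "a + b < 2 ^ Suc (len a + len b - 2)"
    by simp
  also have "Suc (len a + len b - 2) = len a + len b - 1"
    using len_pos[of a] len_pos[of b] by simp
  finally show ?thesis
    using len_pos[of a] by (simp add: len_le_iff)
qed

lemma len_le_Suc: "len n \<le> n + 1"
  by (simp add: len_le_iff)

lemma len_power: "len (a ^ i) \<le> i * len a + 2"
proof (induction i)
  case 0
  then show ?case by (simp add: len_le_iff)
next
  case (Suc i)
  then show ?case using len_mult[of a "a ^ i"] by simp
qed

section \<open>Expression costs in a memory whose entries have bounded length\<close>

definition bounded_mem :: "nat \<Rightarrow> memory \<Rightarrow> bool" where
  "bounded_mem W s \<longleftrightarrow> (\<forall>x i. len (s x i) \<le> W)"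

lemma bounded_mem_store: "bounded_mem W s \<Longrightarrow> len n \<le> W \<Longrightarrow> bounded_mem W (store s x i n)"
  by (simp add: bounded_mem_def store_def)

text \<open>A read counts one because the cell content is bounded whatever its address. Differences
  and quotients count only the first operand, which their results never exceed.\<close>

fun len_factor :: "aexp \<Rightarrow> nat" where
  "len_factor (Num n) = len n"
| "len_factor (Cell x a) = 1"
| "len_factor (Add a b) = len_factor a + len_factor b"
| "len_factor (Sub a b) = len_factor a"
| "len_factor (Mul a b) = len_factor a + len_factor b"
| "len_factor (Quot a b) = len_factor a"

fun cost_factor :: "aexp \<Rightarrow> nat" where
  "cost_factor (Num n) = len n"
| "cost_factor (Cell x a) = cost_factor a + 1"
| "cost_factor (Add a b) = cost_factor a + cost_factor b + len_factor (Add a b)"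
| "cost_factor (Sub a b) = cost_factor a + cost_factor b + len_factor (Sub a b)"
| "cost_factor (Mul a b) = cost_factor a + cost_factor b + len_factor (Mul a b)"
| "cost_factor (Quot a b) = cost_factor a + cost_factor b + len_factor (Quot a b)"

lemma bounded_mem_pos: "bounded_mem W s \<Longrightarrow> 0 < W"
  unfolding bounded_mem_def using len_pos by (metis le_zero_eq not_gr_zero)

lemma len_aval_le:
  assumes "bounded_mem W s"
  shows "len (aval a s) \<le> len_factor a * W"
proof (induction a)
  case (Num n)
  then show ?case using bounded_mem_pos[OF assms] by simp
next
  case (Cell x a)
  then show ?case using assms by (simp add: bounded_mem_def)
next
  case (Add a b)
  then show ?case using len_add[of "aval a s" "aval b s"] by (simp add: algebra_simps)
next
  case (Sub a b)
  then show ?case using len_mono[of "aval a s - aval b s" "aval a s"] by simp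
next
  case (Mul a b)
  then show ?case using len_mult[of "aval a s" "aval b s"] by (simp add: algebra_simps)
next
  case (Quot a b)
  then show ?case using len_mono[of "aval a s div aval b s" "aval a s"] by simp
qed

lemma acost_le:
  assumes "bounded_mem W s"
  shows "acost a s \<le> cost_factor a * W"
proof (induction a)
  case (Num n)
  then show ?case using bounded_mem_pos[OF assms] by simp
next
  case (Cell x a)
  then show ?case
    using len_aval_le[OF assms, of "Cell x a"] by (simp add: algebra_simps)
next
  case (Add a b)
  then show ?case
    using len_aval_le[OF assms, of "Add a b"] by (simp add: algebra_simps)
next
  case (Sub a b)
  then show ?case
    using len_aval_le[OF assms, of "Sub a b"] by (simp add: algebra_simps)
next
  case (Mul a b)
  then show ?case
    using len_aval_le[OF assms, of "Mul a b"] by (simp add: algebra_simps)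
next
  case (Quot a b)
  then show ?case
    using len_aval_le[OF assms, of "Quot a b"] by (simp add: algebra_simps)
qed

section \<open>Deterministic executions with an upper bound on the cost, and counting loops\<close>

definition runs :: "com \<Rightarrow> memory \<Rightarrow> memory \<Rightarrow> nat \<Rightarrow> bool" where
  "runs c s s' t \<longleftrightarrow> (\<exists>t'\<le>t. exec c s (return_pmf (s', t')))"

lemma runs_mono: "runs c s s' t \<Longrightarrow> t \<le> u \<Longrightarrow> runs c s s' u"
  unfolding runs_def by (meson le_trans)

lemma runs_Skip: "runs Skip s s 1"
  unfolding runs_def using exec.Skip by blast

lemma runs_Store:
  "runs (Store x a b) s (store s x (aval a s) (aval b s)) (1 + acost a s + acost b s)"
  unfolding runs_def using exec.Store by blast

lemma runs_Seq:
  assumes "runs c s s' t" "runs d s' s'' u"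
  shows "runs (Seq c d) s s'' (t + u)"
proof -
  obtain t' u' where le: "t' \<le> t" "u' \<le> u"
    and ex: "exec c s (return_pmf (s', t'))" "exec d s' (return_pmf (s'', u'))"
    using assms unfolding runs_def by blast
  have "exec (Seq c d) s (bind_pmf (return_pmf (s', t'))
      (\<lambda>(s', t). add_cost t ((\<lambda>_. return_pmf (s'', u')) s')))"
    using ex by (intro exec.Seq) auto
  then have "exec (Seq c d) s (return_pmf (s'', t' + u'))"
    by (simp add: bind_return_pmf add_cost_def)
  then show ?thesis
    unfolding runs_def using le add_mono by blast
qed

lemma runs_CondTrue:
  assumes "aval a s \<noteq> 0" "runs c s s' t"
  shows "runs (Cond a c d) s s' (1 + acost a s + t)"
proof -
  obtain t' where le: "t' \<le> t" and ex: "exec c s (return_pmf (s', t'))"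
    using assms unfolding runs_def by blast
  show ?thesis
    unfolding runs_def using exec.CondTrue[OF assms(1) ex, of d] le
    by (intro exI[of _ "1 + acost a s + t'"]) (simp add: add_cost_def)
qed

lemma runs_CondFalse:
  assumes "aval a s = 0" "runs d s s' t"
  shows "runs (Cond a c d) s s' (1 + acost a s + t)"
proof -
  obtain t' where le: "t' \<le> t" and ex: "exec d s (return_pmf (s', t'))"
    using assms unfolding runs_def by blast
  show ?thesis
    unfolding runs_def using exec.CondFalse[OF assms(1) ex, of c] le
    by (intro exI[of _ "1 + acost a s + t'"]) (simp add: add_cost_def)
qed

lemma runs_WhileFalse: "aval a s = 0 \<Longrightarrow> runs (While a c) s s (1 + acost a s)"
  unfolding runs_def using exec.WhileFalse by blast

lemma runs_WhileTrue:
  assumes "aval a s \<noteq> 0" "runs c s s' t" "runs (While a c) s' s'' u"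
  shows "runs (While a c) s s'' (1 + acost a s + t + u)"
proof -
  obtain t' u' where le: "t' \<le> t" "u' \<le> u"
    and ex: "exec c s (return_pmf (s', t'))" "exec (While a c) s' (return_pmf (s'', u'))"
    using assms unfolding runs_def by blast
  have "exec (While a c) s (add_cost (1 + acost a s) (bind_pmf (return_pmf (s', t'))
      (\<lambda>(s', t). add_cost t ((\<lambda>_. return_pmf (s'', u')) s'))))"
    using assms(1) ex by (intro exec.WhileTrue) auto
  then have "exec (While a c) s (return_pmf (s'', 1 + acost a s + (t' + u')))"
    by (simp add: bind_return_pmf add_cost_def)
  then show ?thesis
    unfolding runs_def using le by (intro exI[of _ "1 + acost a s + (t' + u')"]) simp
qed

text \<open>Subtraction truncates at 0, so the guard is nonzero exactly while the counter in
  \<open>x\<close> is below the bound in \<open>y\<close>.\<close>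

definition for_loop :: "nat \<Rightarrow> nat \<Rightarrow> com \<Rightarrow> com" where
  "for_loop x y c = Seq (Store x (Num 0) (Num 0))
     (While (Sub (Cell y (Num 0)) (Cell x (Num 0)))
       (Seq c (Store x (Num 0) (Add (Cell x (Num 0)) (Num 1)))))"

definition for_step :: "nat \<Rightarrow> (memory \<Rightarrow> memory) \<Rightarrow> memory \<Rightarrow> memory" where
  "for_step x h s = (let s' = h s in store s' x 0 (Suc (s' x 0)))"

text \<open>The assumptions on the body concern only the memories \<open>st s x i\<close> that the
  loop passes through. Outside the body a round costs at most \<open>30 * W\<close>; the
  initialization and the last test add \<open>20 * W\<close>.\<close>

lemma runs_for_loop:
  fixes h :: "memory \<Rightarrow> memory"
  defines "st \<equiv> \<lambda>s x i. (for_step x h ^^ i) (store s x 0 0)"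
  assumes n: "s y 0 = n" and xy: "x \<noteq> y" and bs: "bounded_mem W s"
    and body: "\<And>i. i < n \<Longrightarrow> runs c (st s x i) (h (st s x i)) t"
    and keep: "\<And>i. i < n \<Longrightarrow> h (st s x i) x 0 = st s x i x 0 \<and> h (st s x i) y 0 = st s x i y 0"
    and bd: "\<And>i. i < n \<Longrightarrow> bounded_mem W (h (st s x i))"
  shows "runs (for_loop x y c) s (st s x n) ((n + 1) * (t + 40 * W)) \<and> bounded_mem W (st s x n)"
proof -
  have W: "0 < W" using bs by (rule bounded_mem_pos)
  have len: "len 0 = 1" "len (Suc 0) = 2"
    by (auto simp: len_def floorlog_def)
  have cnt: "st s x i x 0 = i \<and> st s x i y 0 = n" if "i \<le> n" for i
    using that
  proof (induction i)
    case 0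
    then show ?case using n xy by (simp add: st_def store_def)
  next
    case (Suc i)
    then show ?case
      using keep[of i] xy by (simp add: st_def store_def for_step_def Let_def)
  qed
  have len_n: "len i \<le> W" if "i \<le> n" for i
    using that n bs len_mono order_trans unfolding bounded_mem_def by metis
  have bst: "bounded_mem W (st s x i)" if "i \<le> n" for i
  proof (cases i)
    case 0
    then show ?thesis
      using bs len_n[of 0] by (simp add: st_def store_def bounded_mem_def)
  next
    case (Suc j)
    then have eq: "st s x i = store (h (st s x j)) x 0 i"
      using keep[of j] cnt[of j] that by (simp add: st_def for_step_def Let_def)
    show ?thesis
      using bd[of j] Suc that len_n[OF that] unfolding eq by (simp add: store_def bounded_mem_def)
  qed
  let ?cond = "Sub (Cell y (Num 0)) (Cell x (Num 0))"
  let ?inc = "Store x (Num 0) (Add (Cell x (Num 0)) (Num 1))"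
  let ?loop = "While ?cond (Seq c ?inc)"
  have cond: "1 + acost ?cond (st s x i) \<le> 10 * W" if "i \<le> n" for i
    using acost_le[OF bst[OF that], of ?cond] W len by simp
  \<comment> \<open>Induction on the number \<open>j\<close> of rounds still to go, since the rule
    for \<open>While\<close> peels off the first of them.\<close>
  have loop: "runs ?loop (st s x (n - j)) (st s x n) (j * (t + 30 * W) + 10 * W)" if "j \<le> n" for j
    using that
  proof (induction j)
    case 0
    have "aval ?cond (st s x n) = 0" using cnt[of n] by simp
    from runs_WhileFalse[OF this, of "Seq c ?inc"] show ?case
      using cond[of n] by (auto elim!: runs_mono)
  next
    case (Suc j)
    let ?i = "n - Suc j"
    have i: "?i < n" and Si: "Suc ?i = n - j" using Suc.prems by auto
    have ne: "aval ?cond (st s x ?i) \<noteq> 0" using cnt[of ?i] i by simp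
    have "runs ?inc (h (st s x ?i)) (store (h (st s x ?i)) x 0 (Suc (h (st s x ?i) x 0))) (20 * W)"
      using runs_Store[of x "Num 0" "Add (Cell x (Num 0)) (Num 1)" "h (st s x ?i)"]
        acost_le[OF bd[OF i], of "Num 0"] W len
        acost_le[OF bd[OF i], of "Add (Cell x (Num 0)) (Num 1)"]
      by (auto elim!: runs_mono)
    then have "runs ?inc (h (st s x ?i)) (st s x (Suc ?i)) (20 * W)"
      by (simp add: st_def for_step_def Let_def)
    from runs_Seq[OF body[OF i] this]
    have "runs (Seq c ?inc) (st s x ?i) (st s x (n - j)) (t + 20 * W)"
      unfolding Si .
    from runs_WhileTrue[OF ne this Suc.IH] Suc.prems
    show ?case using cond[of ?i] i by (auto elim!: runs_mono)
  qed
  have "runs (Store x (Num 0) (Num 0)) s (st s x 0) (10 * W)"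
    using runs_Store[of x "Num 0" "Num 0" s] W len by (auto elim!: runs_mono simp: st_def)
  moreover have "runs ?loop (st s x 0) (st s x n) (n * (t + 30 * W) + 10 * W)"
    using loop[of n] by simp
  ultimately have "runs (for_loop x y c) s (st s x n) (10 * W + (n * (t + 30 * W) + 10 * W))"
    unfolding for_loop_def by (rule runs_Seq)
  then have "runs (for_loop x y c) s (st s x n) ((n + 1) * (t + 40 * W))"
    by (rule runs_mono) (simp add: algebra_simps)
  with bst[of n] show ?thesis by simp
qed

section \<open>A structured language whose cost is bounded by its syntax\<close>

datatype prog =
    Asg nat aexp aexp
  | Then prog prog  (infixr ";;" 60)
  | When aexp prog
  | For nat nat prog

text \<open>An assignment truncates its value at the content of cell 0 of bank 2. So memory stays bounded by
  construction, and the cost of a program can be bounded from its syntax alone.\<close>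

fun compile :: "prog \<Rightarrow> com" where
  "compile (Asg x a b) = Store x a (Sub b (Sub b (Cell 2 (Num 0))))"
| "compile (p ;; q) = Seq (compile p) (compile q)"
| "compile (When a p) = Cond a (compile p) Skip"
| "compile (For x y p) = for_loop x y (compile p)"

fun sem :: "prog \<Rightarrow> memory \<Rightarrow> memory" where
  "sem (Asg x a b) s = store s x (aval a s) (min (aval b s) (s 2 0))"
| "sem (p ;; q) s = sem q (sem p s)"
| "sem (When a p) s = (if aval a s \<noteq> 0 then sem p s else s)"
| "sem (For x y p) s = (for_step x (sem p) ^^ (s y 0)) (store s x 0 0)"

fun writes :: "prog \<Rightarrow> nat set" where
  "writes (Asg x a b) = {x}"
| "writes (p ;; q) = writes p \<union> writes q"
| "writes (When a p) = writes p"
| "writes (For x y p) = insert x (writes p)"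

text \<open>Loop bounds sit in banks 3, 4, 5, which \<open>runs_compile\<close> assumes to be
  read-only, and no body touches its own counter. So a loop makes exactly as many rounds as its
  bound says on entry.\<close>

fun safe :: "prog \<Rightarrow> bool" where
  "safe (Asg x a b) \<longleftrightarrow> True"
| "safe (p ;; q) \<longleftrightarrow> safe p \<and> safe q"
| "safe (When a p) \<longleftrightarrow> safe p"
| "safe (For x y p) \<longleftrightarrow> safe p \<and> x \<notin> writes p \<and> y \<in> {3, 4, 5}"

fun depth :: "prog \<Rightarrow> nat" where
  "depth (Asg x a b) = 0"
| "depth (p ;; q) = max (depth p) (depth q)"
| "depth (When a p) = depth p"
| "depth (For x y p) = Suc (depth p)"

fun prog_factor :: "prog \<Rightarrow> nat" where
  "prog_factor (Asg x a b) = 1 + cost_factor a + cost_factor (Sub b (Sub b (Cell 2 (Num 0))))"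
| "prog_factor (p ;; q) = prog_factor p + prog_factor q"
| "prog_factor (When a p) = 2 + cost_factor a + prog_factor p"
| "prog_factor (For x y p) = prog_factor p + 40"

lemma sem_frame: "z \<notin> writes p \<Longrightarrow> sem p s z = s z"
proof (induction p arbitrary: s)
  case (For x y p)
  have "(for_step x (sem p) ^^ i) (store s x 0 0) z = s z" for i
    using For by (induction i) (auto simp: store_def for_step_def Let_def)
  then show ?case by simp
qed (auto simp: store_def)

text \<open>The bound \<open>W\<close> survives each construct: assignments truncate at a cell of
  length at most \<open>W\<close>, and counters, which bypass the truncation, never exceed a loop
  bound stored in memory. As \<open>T\<close> bounds all loop bounds, each nesting level multiplies
  the cost by at most \<open>T + 1\<close>.\<close>

lemma runs_compile:
  assumes "safe p" "writes p \<inter> {2, 3, 4, 5} = {}" "bounded_mem W s"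
    and "\<forall>y\<in>{3, 4, 5}. s y 0 \<le> T"
  shows "runs (compile p) s (sem p s) (prog_factor p * (T + 1) ^ depth p * W)
    \<and> bounded_mem W (sem p s)"
  using assms
proof (induction p arbitrary: s)
  case (Asg x a b)
  have W: "0 < W" using Asg.prems(3) by (rule bounded_mem_pos)
  have "aval b s - (aval b s - s 2 0) = min (aval b s) (s 2 0)" by simp
  then have run: "runs (compile (Asg x a b)) s (sem (Asg x a b) s)
      (1 + acost a s + acost (Sub b (Sub b (Cell 2 (Num 0)))) s)"
    using runs_Store[of x a "Sub b (Sub b (Cell 2 (Num 0)))" s] by simp
  have "1 + acost a s + acost (Sub b (Sub b (Cell 2 (Num 0)))) s
      \<le> 1 * W + cost_factor a * W + cost_factor (Sub b (Sub b (Cell 2 (Num 0)))) * W"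
    using W by (intro add_mono acost_le Asg.prems) auto
  also have "\<dots> = prog_factor (Asg x a b) * (T + 1) ^ depth (Asg x a b) * W"
    by (simp add: algebra_simps)
  finally have "runs (compile (Asg x a b)) s (sem (Asg x a b) s)
      (prog_factor (Asg x a b) * (T + 1) ^ depth (Asg x a b) * W)"
    by (rule runs_mono[OF run])
  moreover have "len (min (aval b s) (s 2 0)) \<le> W"
    using Asg.prems(3) len_mono[of "min (aval b s) (s 2 0)" "s 2 0"]
    unfolding bounded_mem_def by (meson le_trans min.cobounded2)
  then have "bounded_mem W (sem (Asg x a b) s)"
    using Asg.prems(3) by (simp add: bounded_mem_def store_def)
  ultimately show ?case by blast
next
  case (Then p q)
  let ?s = "sem p s"
  have p: "runs (compile p) s ?s (prog_factor p * (T + 1) ^ depth p * W)" "bounded_mem W ?s"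
    using Then by auto
  have fr: "\<forall>y\<in>{3, 4, 5}. ?s y 0 \<le> T"
    using Then.prems sem_frame[of _ p s] by auto
  have q: "runs (compile q) ?s (sem q ?s) (prog_factor q * (T + 1) ^ depth q * W)"
    "bounded_mem W (sem q ?s)"
    using Then.IH(2)[of ?s] Then.prems p(2) fr by auto
  have "prog_factor p * (T + 1) ^ depth p * W + prog_factor q * (T + 1) ^ depth q * W
      \<le> prog_factor p * (T + 1) ^ max (depth p) (depth q) * W
        + prog_factor q * (T + 1) ^ max (depth p) (depth q) * W"
    by (intro add_mono mult_mono power_increasing) auto
  with runs_Seq[OF p(1) q(1)] q(2) show ?case
    by (auto elim!: runs_mono simp: algebra_simps)
next
  case (When a p)
  have W: "0 < W" using When.prems(3) by (rule bounded_mem_pos)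
  have IH: "runs (compile p) s (sem p s) (prog_factor p * (T + 1) ^ depth p * W)"
    "bounded_mem W (sem p s)"
    using When by auto
  let ?X = "(T + 1) ^ depth p"
  have X: "1 \<le> ?X" by simp
  have "cost_factor a * 1 * W \<le> cost_factor a * ?X * W"
    using X by (intro mult_le_mono) auto
  then have ac: "acost a s \<le> cost_factor a * ?X * W"
    using acost_le[OF When.prems(3), of a] unfolding mult_1_right by (rule order_trans[rotated])
  have two: "2 \<le> 2 * ?X * W"
    using W by simp
  have bound: "2 + acost a s + prog_factor p * ?X * W \<le> prog_factor (When a p) * ?X * W"
    unfolding prog_factor.simps add_mult_distrib using ac two by linarith
  show ?case
  proof (cases "aval a s = 0")
    case True
    then show ?thesis
      using runs_mono[OF runs_CondFalse[OF True runs_Skip, of "compile p"], of "2 + acost a s + prog_factor p * ?X * W"]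
        bound When.prems(3) by (auto elim!: runs_mono)
  next
    case False
    show ?thesis
      using runs_mono[OF runs_CondTrue[OF False IH(1), of Skip], of "2 + acost a s + prog_factor p * ?X * W"]
        bound False IH(2) by (auto elim!: runs_mono)
  qed
next
  case (For x y p)
  let ?st = "\<lambda>i. (for_step x (sem p) ^^ i) (store s x 0 0)"
  let ?n = "s y 0"
  have W: "0 < W" using For.prems(3) by (rule bounded_mem_pos)
  have xy: "x \<noteq> y" and xw: "x \<notin> writes p" and yw: "y \<notin> writes p" and nT: "?n \<le> T"
    and sp: "safe p" and wp: "writes p \<inter> {2, 3, 4, 5} = {}" and x: "x \<notin> {2, 3, 4, 5}"
    using For.prems by auto
  have fr: "?st i z = s z" if "z \<in> {2, 3, 4, 5}" for i z
    using that wp x by (induction i) (auto simp: for_step_def Let_def store_def sem_frame)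
  have cnt: "?st i x 0 = i" for i
    using xw by (induction i) (auto simp: for_step_def Let_def store_def sem_frame)
  have bst: "bounded_mem W (?st i)" if "i \<le> ?n" for i
    using that
  proof (induction i)
    case 0
    then show ?case
      using For.prems(3) len_mono[of 0 ?n] by (auto simp: bounded_mem_def store_def intro: le_trans)
  next
    case (Suc i)
    then have "bounded_mem W (?st i)" by simp
    then have b: "bounded_mem W (sem p (?st i))"
      using For.IH[of "?st i"] sp wp fr[of 3 i] fr[of 4 i] fr[of 5 i] For.prems(4) by simp
    have "len (Suc i) \<le> W"
      using Suc.prems len_mono[of "Suc i" ?n] For.prems(3) unfolding bounded_mem_def by (meson le_trans)
    moreover have "?st (Suc i) = store (sem p (?st i)) x 0 (Suc i)"
      using cnt[of i] xw by (simp add: for_step_def Let_def sem_frame)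
    ultimately show ?case
      using bounded_mem_store[OF b] by metis
  qed
  have IH: "runs (compile p) (?st i) (sem p (?st i)) (prog_factor p * (T + 1) ^ depth p * W)
      \<and> bounded_mem W (sem p (?st i))" if "i < ?n" for i
    using For.IH[of "?st i"] bst[of i] that sp wp fr[of 3 i] fr[of 4 i] fr[of 5 i] For.prems(4) by simp
  have "runs (for_loop x y (compile p)) s (?st ?n)
      ((?n + 1) * (prog_factor p * (T + 1) ^ depth p * W + 40 * W)) \<and> bounded_mem W (?st ?n)"
    using IH xw yw by (intro runs_for_loop) (use For.prems(3) xy in \<open>auto simp: sem_frame\<close>)
  moreover have "(?n + 1) * (prog_factor p * (T + 1) ^ depth p * W + 40 * W)
      \<le> (T + 1) * (prog_factor p * (T + 1) ^ depth p * W + 40 * (T + 1) ^ depth p * W)"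
    using nT by (intro mult_mono add_mono) auto
  ultimately show ?case
    by (auto elim!: runs_mono simp: algebra_simps)
qed

text \<open>An invariant rule. Banks that the body does not write keep their contents from the
  start, so the invariant need not carry them.\<close>

lemma For_rule:
  assumes "x \<notin> writes p" "y \<notin> writes p" "x \<noteq> y" "s y 0 = n"
    and base: "I 0 (store s x 0 0)"
    and step: "\<And>i s'. \<lbrakk>i < n; I i s'; s' x 0 = i; \<And>z. z \<notin> writes p \<Longrightarrow> z \<noteq> x \<Longrightarrow> s' z = s z\<rbrakk>
      \<Longrightarrow> I (Suc i) (store (sem p s') x 0 (Suc i))"
  shows "I n (sem (For x y p) s)"
proof -
  let ?st = "\<lambda>i. (for_step x (sem p) ^^ i) (store s x 0 0)"
  have "i \<le> n \<longrightarrow> I i (?st i) \<and> ?st i x 0 = i \<and> (\<forall>z. z \<notin> writes p \<longrightarrow> z \<noteq> x \<longrightarrow> ?st i z = s z)" for i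
  proof (induction i)
    case 0
    have "store s x 0 0 x 0 = 0" "\<And>z. z \<noteq> x \<Longrightarrow> store s x 0 0 z = s z"
      by (simp_all add: store_def)
    then show ?case using base by simp
  next
    case (Suc i)
    show ?case
    proof
      assume i: "Suc i \<le> n"
      have IH: "I i (?st i)" "?st i x 0 = i" "\<And>z. z \<notin> writes p \<Longrightarrow> z \<noteq> x \<Longrightarrow> ?st i z = s z"
        using Suc i by auto
      have eq: "?st (Suc i) = store (sem p (?st i)) x 0 (Suc i)"
        using IH(2) assms(1) by (simp add: for_step_def Let_def sem_frame)
      have "I (Suc i) (?st (Suc i))"
        unfolding eq by (rule step) (use IH i in auto)
      moreover have "?st (Suc i) x 0 = Suc i"
        unfolding eq by (simp add: store_def)
      moreover have "?st (Suc i) z = s z" if "z \<notin> writes p" "z \<noteq> x" for z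
        unfolding eq using that IH(3)[of z] by (simp add: store_def sem_frame)
      ultimately show "I (Suc i) (?st (Suc i)) \<and> ?st (Suc i) x 0 = Suc i \<and>
          (\<forall>z. z \<notin> writes p \<longrightarrow> z \<noteq> x \<longrightarrow> ?st (Suc i) z = s z)"
        by blast
    qed
  qed
  then show ?thesis using assms(4) by simp
qed

section \<open>Greedy selection guided by potentials\<close>

definition hits :: "(nat \<Rightarrow> 'v set) \<Rightarrow> nat set \<Rightarrow> 'v \<Rightarrow> nat" where
  "hits E S v = card {j \<in> S. v \<in> E j}"

lemma hits_insert:
  assumes "finite S" "e \<notin> S"
  shows "hits E (insert e S) v = hits E S v + (if v \<in> E e then 1 else 0)"
proof -
  have "{j \<in> insert e S. v \<in> E j} = (if v \<in> E e then insert e {j \<in> S. v \<in> E j} else {j \<in> S. v \<in> E j})"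
    by auto
  then show ?thesis using assms by (auto simp: hits_def)
qed

lemma hits_Diff:
  assumes "finite S" "finite J"
  shows "hits E J v \<le> hits E (J - S) v + hits E S v"
proof -
  have "{j \<in> J. v \<in> E j} \<subseteq> {j \<in> J - S. v \<in> E j} \<union> {j \<in> S. v \<in> E j}" by auto
  then have "card {j \<in> J. v \<in> E j} \<le> card ({j \<in> J - S. v \<in> E j} \<union> {j \<in> S. v \<in> E j})"
    using assms by (intro card_mono) auto
  also have "\<dots> \<le> card {j \<in> J - S. v \<in> E j} + card {j \<in> S. v \<in> E j}"
    by (rule card_Un_le)
  finally show ?thesis by (simp add: hits_def)
qed

lemma hits_mono: "finite T \<Longrightarrow> S \<subseteq> T \<Longrightarrow> hits E S v \<le> hits E T v"
  unfolding hits_def by (rule card_mono) auto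

lemma hits_le_card: "finite S \<Longrightarrow> hits E S v \<le> card S"
  unfolding hits_def by (rule card_mono) auto

text \<open>Double counting of the incidences between \<open>V\<close> and \<open>R\<close>.\<close>

lemma sum_incidences:
  fixes w :: "'v \<Rightarrow> real"
  assumes "finite V" "finite R" "\<And>e. e \<in> R \<Longrightarrow> E e \<subseteq> V"
  shows "(\<Sum>e\<in>R. \<Sum>v\<in>E e. w v) = (\<Sum>v\<in>V. w v * real (hits E R v))"
proof -
  have "(\<Sum>e\<in>R. \<Sum>v\<in>E e. w v) = (\<Sum>e\<in>R. \<Sum>v | v \<in> V \<and> v \<in> E e. w v)"
    using assms(3) by (intro sum.cong refl) (auto intro: arg_cong2[where f = sum])
  also have "\<dots> = (\<Sum>v\<in>V. \<Sum>e | e \<in> R \<and> v \<in> E e. w v)"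
    using assms by (intro sum.swap_restrict)
  finally show ?thesis by (simp add: hits_def mult.commute)
qed

text \<open>From \<open>ln (1 - x) \<ge> - x - 2 * x^2\<close> and \<open>2 * x^2 \<le> x\<close>.
  Later this keeps the weight of an unsaturated vertex away from 0.\<close>

lemma one_minus_ge_exp:
  fixes x :: real
  assumes "0 \<le> x" "x \<le> 1 / 2"
  shows "exp (- (2 * x)) \<le> 1 - x"
proof -
  have "x * x \<le> x * (1 / 2)" using assms by (intro mult_left_mono)
  then have "- (2 * x) \<le> ln (1 - x)"
    using ln_one_minus_pos_lower_bound[OF assms] by (simp add: power2_eq_square)
  then have "exp (- (2 * x)) \<le> exp (ln (1 - x))" by simp
  then show ?thesis using assms by simp
qed

text \<open>From \<open>exp (x / 2) \<le> 1 + x / 2 + x^2 / 4\<close>. Later this makes the weight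
  of a vertex of high degree exponentially large.\<close>

lemma one_plus_ge_exp:
  fixes x :: real
  assumes "0 \<le> x" "x \<le> 1"
  shows "exp (x / 2) \<le> 1 + x"
proof -
  have "x * x \<le> x * 1" using assms by (intro mult_left_mono)
  then show ?thesis
    using exp_bound[of "x / 2"] assms by (simp add: power2_eq_square)
qed

text \<open>The exchange rate between the two potentials: by Bernoulli's inequality a relative gain of at
  most \<open>3 y\<close> in \<open>P\<close> is paid for by a relative loss of \<open>y\<close> in \<open>Q\<close>.\<close>

lemma exchange_potentials:
  fixes P Q A B :: real
  assumes "0 < P" "0 < Q" "0 \<le> B" "B \<le> Q" "A * Q \<le> 3 * B * P"
  shows "(P + A) * (Q - B) ^ 3 \<le> P * Q ^ 3"
proof -
  define y where "y = B / Q"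
  have y: "0 \<le> y" "y \<le> 1" and B: "B = y * Q"
    using assms by (auto simp: y_def)
  have "A * Q \<le> (3 * y * P) * Q" using assms(5) B by (simp add: algebra_simps)
  then have "A \<le> 3 * y * P" using assms(2) by simp
  then have "P + A \<le> P * (1 + 3 * y)" by (simp add: algebra_simps)
  also have "\<dots> \<le> P * (1 + y) ^ 3"
    using Bernoulli_inequality[of y 3] y assms(1) by (intro mult_left_mono) auto
  finally have "(P + A) * (Q - B) ^ 3 \<le> (P * (1 + y) ^ 3) * (Q - B) ^ 3"
    using assms by (intro mult_right_mono) auto
  also have "\<dots> = (P * (1 + y) ^ 3) * ((1 - y) * Q) ^ 3"
    by (simp add: B algebra_simps)
  also have "(P * (1 + y) ^ 3) * ((1 - y) * Q) ^ 3 = P * Q ^ 3 * (1 - y\<^sup>2) ^ 3"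
    by (simp add: power_mult_distrib[symmetric] power2_eq_square algebra_simps)
  also have "\<dots> \<le> P * Q ^ 3 * 1"
    using y assms by (intro mult_left_mono power_le_one) (auto simp: power_le_one)
  finally show ?thesis by simp
qed

section \<open>Potentials, candidate edges and sweeps over the edges\<close>

locale greedy =
  fixes V :: "'v set" and E :: "nat \<Rightarrow> 'v set" and m :: nat
    and g f :: "'v \<Rightarrow> nat" and lam mu :: "'v \<Rightarrow> real"
  assumes finite_V: "finite V" and E_sub: "e < m \<Longrightarrow> E e \<subseteq> V"
    and lam_nonneg: "v \<in> V \<Longrightarrow> 0 \<le> lam v" and lam_le_1: "v \<in> V \<Longrightarrow> lam v \<le> 1"
    and mu_nonneg: "v \<in> V \<Longrightarrow> 0 \<le> mu v" and mu_le: "v \<in> V \<Longrightarrow> mu v \<le> 1 / 2"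
begin

definition p :: "nat set \<Rightarrow> 'v \<Rightarrow> real" where
  "p S v = (1 + lam v) ^ hits E S v"

text \<open>A saturated vertex drops out with weight 0. All other weights are positive, so the sum
  over \<open>V\<close> vanishes exactly when every vertex is saturated.\<close>

definition q :: "nat set \<Rightarrow> 'v \<Rightarrow> real" where
  "q S v = (if 40 * hits E S v < g v then (1 - mu v) ^ hits E S v else 0)"

text \<open>The inequality is the premise of \<open>exchange_potentials\<close> for the increase of
  \<open>P\<close> and the guaranteed decrease of \<open>Q\<close>, in a form free of division by
  \<open>P\<close> or \<open>Q\<close>.\<close>

definition cand :: "nat set \<Rightarrow> nat \<Rightarrow> bool" where
  "cand S e \<longleftrightarrow> e \<notin> S \<and> sum (q S) V \<noteq> 0 \<and>
     (\<Sum>v\<in>E e. p S v * lam v) * sum (q S) V \<le> 3 * (\<Sum>v\<in>E e. q S v * mu v) * sum (p S) V"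

definition add_edge :: "nat set \<Rightarrow> nat \<Rightarrow> nat set" where
  "add_edge S e = (if cand S e then insert e S else S)"

definition pass :: "nat set \<Rightarrow> nat set" where
  "pass S = foldl add_edge S [0..<m]"

lemma p_ge_1: "v \<in> V \<Longrightarrow> 1 \<le> p S v"
  by (simp add: p_def lam_nonneg)

lemma p_nonneg: "v \<in> V \<Longrightarrow> 0 \<le> p S v"
  using p_ge_1[of v S] by linarith

lemma q_nonneg: "v \<in> V \<Longrightarrow> 0 \<le> q S v"
  using mu_le[of v] by (simp add: q_def)

lemma P_pos: "V \<noteq> {} \<Longrightarrow> 0 < sum (p S) V"
  using finite_V p_ge_1 by (intro sum_pos) (auto intro: less_le_trans[OF zero_less_one])

lemma potential_add_edge:
  assumes S: "finite S" and e: "e < m" and c: "cand S e"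
  shows "sum (p (insert e S)) V * sum (q (insert e S)) V ^ 3 \<le> sum (p S) V * sum (q S) V ^ 3"
proof -
  have eS: "e \<notin> S" and Q0: "sum (q S) V \<noteq> 0" using c by (auto simp: cand_def)
  have V0: "V \<noteq> {}" using Q0 by auto
  have EV: "V \<inter> E e = E e" using E_sub[OF e] by auto
  let ?A = "\<Sum>v\<in>E e. p S v * lam v" and ?B = "\<Sum>v\<in>E e. q S v * mu v"
  have "sum (p (insert e S)) V = (\<Sum>v\<in>V. p S v + (if v \<in> E e then p S v * lam v else 0))"
    by (intro sum.cong refl) (simp add: p_def hits_insert[OF S eS] algebra_simps)
  also have "\<dots> = sum (p S) V + ?A"
    using finite_V by (simp add: sum.distrib sum.If_cases EV)
  finally have P': "sum (p (insert e S)) V = sum (p S) V + ?A" .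
  \<comment> \<open>Only an inequality: a vertex that \<open>e\<close> saturates loses its whole
    weight, not just the fraction \<open>mu v\<close> of it.\<close>
  have "sum (q (insert e S)) V \<le> (\<Sum>v\<in>V. q S v - (if v \<in> E e then q S v * mu v else 0))"
  proof (rule sum_mono)
    fix v assume v: "v \<in> V"
    have "q S v * mu v \<le> q S v"
      using mu_le[OF v] q_nonneg[OF v, of S] by (intro mult_left_le) auto
    then show "q (insert e S) v \<le> q S v - (if v \<in> E e then q S v * mu v else 0)"
      by (auto simp: q_def hits_insert[OF S eS] algebra_simps)
  qed
  also have "\<dots> = sum (q S) V - ?B"
    using finite_V by (simp add: sum_subtractf sum.If_cases EV)
  finally have Q': "sum (q (insert e S)) V \<le> sum (q S) V - ?B" .
  have Q'0: "0 \<le> sum (q (insert e S)) V" by (intro sum_nonneg q_nonneg)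
  have Q: "0 < sum (q S) V"
    using Q0 sum_nonneg[of V "q S"] q_nonneg by fastforce
  have A: "0 \<le> ?A" and B: "0 \<le> ?B"
    using E_sub[OF e] q_nonneg mu_nonneg lam_nonneg p_nonneg
    by (auto intro!: sum_nonneg mult_nonneg_nonneg)
  have "sum (p (insert e S)) V * sum (q (insert e S)) V ^ 3 \<le> (sum (p S) V + ?A) * (sum (q S) V - ?B) ^ 3"
    unfolding P' using Q' Q'0 A P_pos[OF V0, of S] by (intro mult_left_mono power_mono) auto
  also have "\<dots> \<le> sum (p S) V * sum (q S) V ^ 3"
    using P_pos[OF V0, of S] Q B Q' Q'0 c
    by (intro exchange_potentials) (auto simp: cand_def)
  finally show ?thesis .
qed

lemma add_edge_subset: "e < m \<Longrightarrow> S \<subseteq> {..<m} \<Longrightarrow> S \<subseteq> add_edge S e \<and> add_edge S e \<subseteq> {..<m}"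
  by (auto simp: add_edge_def)

lemma foldl_subset:
  assumes "S \<subseteq> {..<m}" "set xs \<subseteq> {..<m}"
  shows "S \<subseteq> foldl add_edge S xs \<and> foldl add_edge S xs \<subseteq> {..<m}"
  using assms
proof (induction xs arbitrary: S)
  case (Cons e xs)
  then have "S \<subseteq> add_edge S e \<and> add_edge S e \<subseteq> {..<m}"
    by (intro add_edge_subset) auto
  with Cons.IH[of "add_edge S e"] Cons.prems show ?case by auto
qed simp

text \<open>The selection only grows along the list. If it ends where it began, every edge was
  tested against the same \<open>S\<close> and rejected.\<close>

lemma foldl_fixed:
  assumes "S \<subseteq> {..<m}" "set xs \<subseteq> {..<m}" "foldl add_edge S xs = S" "e \<in> set xs"
  shows "\<not> cand S e"
  using assms
proof (induction xs)
  case (Cons x xs)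
  have "S \<subseteq> add_edge S x" "add_edge S x \<subseteq> foldl add_edge (add_edge S x) xs"
    using add_edge_subset[of x S] foldl_subset[of "add_edge S x" xs] Cons.prems by auto
  then have x: "add_edge S x = S" using Cons.prems by auto
  then have "\<not> cand S x" by (auto simp: add_edge_def cand_def split: if_splits)
  then show ?case using Cons x by auto
qed simp

end

section \<open>Correctness of the greedy selection when a feasible solution exists\<close>

locale feasible_greedy = greedy +
  fixes G :: real and J :: "nat set"
  assumes V_nonempty: "V \<noteq> {}" and G_large: "80 * ln (real (card V)) < G"
    and J_sub: "J \<subseteq> {..<m}" and J_lower: "v \<in> V \<Longrightarrow> g v \<le> hits E J v"
    and J_upper: "v \<in> V \<Longrightarrow> hits E J v \<le> f v"
    and lam_f_le: "v \<in> V \<Longrightarrow> lam v * real (f v) \<le> G / 2"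
    and lam_f_ge: "v \<in> V \<Longrightarrow> f v \<le> m \<Longrightarrow> G / 4 \<le> lam v * real (f v)"
    and mu_g_le: "v \<in> V \<Longrightarrow> mu v * real (g v) \<le> G / 2"
    and mu_g_ge: "v \<in> V \<Longrightarrow> G / 4 \<le> mu v * real (g v)"
begin

lemma card_V_ge_1: "1 \<le> real (card V)"
  using finite_V V_nonempty by (simp add: Suc_le_eq card_gt_0_iff)

lemma G_pos: "0 < G"
  using G_large ln_ge_zero[OF card_V_ge_1] by linarith

text \<open>Averaging over the edges of the feasible solution that are not yet selected: an unsaturated
  vertex still has at least 39/40 of its demand among them.\<close>

lemma exists_cand:
  assumes S: "S \<subseteq> {..<m}" and Q0: "sum (q S) V \<noteq> 0"
  shows "\<exists>e<m. cand S e"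
proof (rule ccontr)
  assume none: "\<not> (\<exists>e<m. cand S e)"
  have finS: "finite S" and finJ: "finite J"
    using S J_sub by (auto intro: finite_subset)
  let ?R = "J - S" and ?P = "sum (p S) V" and ?Q = "sum (q S) V"
  have Q: "0 < ?Q"
    using Q0 sum_nonneg[of V "q S"] q_nonneg by fastforce
  have P: "0 < ?P" by (rule P_pos[OF V_nonempty])
  have ER: "E e \<subseteq> V" if "e \<in> ?R" for e using that J_sub E_sub by auto
  have "3 * (\<Sum>v\<in>E e. q S v * mu v) * ?P \<le> (\<Sum>v\<in>E e. p S v * lam v) * ?Q" if "e \<in> ?R" for e
    using none that J_sub Q0 by (force simp: cand_def)
  then have "(\<Sum>e\<in>?R. 3 * (\<Sum>v\<in>E e. q S v * mu v) * ?P) \<le> (\<Sum>e\<in>?R. (\<Sum>v\<in>E e. p S v * lam v) * ?Q)"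
    by (rule sum_mono)
  then have main: "3 * (\<Sum>v\<in>V. q S v * mu v * real (hits E ?R v)) * ?P
      \<le> (\<Sum>v\<in>V. p S v * lam v * real (hits E ?R v)) * ?Q"
    using sum_incidences[where E = E and w = "\<lambda>v. q S v * mu v", OF finite_V finite_Diff[OF finJ] ER]
      sum_incidences[where E = E and w = "\<lambda>v. p S v * lam v", OF finite_V finite_Diff[OF finJ] ER]
    by (simp add: sum_distrib_left[symmetric] sum_distrib_right[symmetric])
  have "p S v * lam v * real (hits E ?R v) \<le> p S v * (G / 2)" if v: "v \<in> V" for v
  proof -
    have "hits E ?R v \<le> f v"
      using hits_mono[OF finJ, of ?R E v] J_upper[OF v] by auto
    then have "lam v * real (hits E ?R v) \<le> lam v * real (f v)"
      using lam_nonneg[OF v] by (intro mult_left_mono) auto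
    then show ?thesis
      using lam_f_le[OF v] p_ge_1[OF v, of S] by (simp add: mult.assoc mult_left_mono)
  qed
  then have "(\<Sum>v\<in>V. p S v * lam v * real (hits E ?R v)) \<le> ?P * (G / 2)"
    unfolding sum_distrib_right by (rule sum_mono)
  then have upper: "(\<Sum>v\<in>V. p S v * lam v * real (hits E ?R v)) * ?Q \<le> ?P * (G / 2) * ?Q"
    using Q by (intro mult_right_mono) auto
  \<comment> \<open>The constant is 39/40, the share of the demand that is left outside
    \<open>S\<close>, times 1/4 from \<open>G / 4 \<le> mu v * g v\<close>.\<close>
  have "q S v * (39 / 160 * G) \<le> q S v * mu v * real (hits E ?R v)" if v: "v \<in> V" for v
  proof (cases "40 * hits E S v < g v")
    case True
    then have "39 / 40 * real (g v) \<le> real (hits E ?R v)"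
      using hits_Diff[OF finS finJ, of E v] J_lower[OF v] by simp
    then have "mu v * (39 / 40 * real (g v)) \<le> mu v * real (hits E ?R v)"
      using mu_nonneg[OF v] by (rule mult_left_mono)
    then have "39 / 160 * G \<le> mu v * real (hits E ?R v)"
      using mu_g_ge[OF v] by simp
    then show ?thesis
      using q_nonneg[OF v, of S] by (simp only: mult.assoc mult_left_mono)
  qed (simp add: q_def)
  then have "?Q * (39 / 160 * G) \<le> (\<Sum>v\<in>V. q S v * mu v * real (hits E ?R v))"
    unfolding sum_distrib_right by (rule sum_mono)
  then have "3 * (?Q * (39 / 160 * G)) * ?P \<le> 3 * (\<Sum>v\<in>V. q S v * mu v * real (hits E ?R v)) * ?P"
    using P by (intro mult_right_mono mult_left_mono) auto
  \<comment> \<open>Here the factor 3 in \<open>cand\<close> pays off: 117/160 is 3 * 39/160, which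
    exceeds the 1/2 coming from \<open>lam v * f v \<le> G / 2\<close>.\<close>
  with main upper have "117 / 160 * (?P * ?Q * G) \<le> 1 / 2 * (?P * ?Q * G)"
    by (simp add: algebra_simps)
  moreover have "0 < ?P * ?Q * G" using P Q G_pos by simp
  ultimately show False by linarith
qed

text \<open>The bound on the potential is that of the empty selection, where \<open>P\<close> is
  \<open>card V\<close> and \<open>Q\<close> is at most \<open>card V\<close>.\<close>

definition good :: "nat set \<Rightarrow> bool" where
  "good S \<longleftrightarrow> S \<subseteq> {..<m} \<and> sum (p S) V * sum (q S) V ^ 3 \<le> real (card V) ^ 4 \<and>
     (\<forall>v\<in>V. hits E S v \<le> f v)"

text \<open>A candidate exists only while some vertex \<open>u\<close> is unsaturated, which bounds
  \<open>Q\<close> from below; a vertex \<open>v\<close> already at \<open>f v\<close> would then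
  make \<open>P\<close> too large for the invariant.\<close>

lemma hits_less_upper:
  assumes S: "good S" and e: "e < m" and c: "cand S e" and v: "v \<in> V"
  shows "hits E S v < f v"
proof (rule ccontr)
  assume "\<not> hits E S v < f v"
  then have ge: "f v \<le> hits E S v" by simp
  have Sm: "S \<subseteq> {..<m}" and PQ: "sum (p S) V * sum (q S) V ^ 3 \<le> real (card V) ^ 4"
    using S by (auto simp: good_def)
  have finS: "finite S" using Sm finite_subset by blast
  \<comment> \<open>A degree of at least \<open>f v\<close> within \<open>S\<close> forces
    \<open>f v \<le> m\<close>, the range in which \<open>lam v * f v\<close> is bounded from
    below.\<close>
  have "insert e S \<subseteq> {..<m}" using Sm e by auto
  then have "card (insert e S) \<le> m" using card_mono[of "{..<m}" "insert e S"] by simp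
  then have fm: "f v \<le> m"
    using ge hits_le_card[OF finS, of E v] c finS by (simp add: cand_def)
  have lam: "0 \<le> lam v" "lam v \<le> 1" using lam_nonneg[OF v] lam_le_1[OF v] by auto
  \<comment> \<open>The bound \<open>lam v * f v \<ge> G / 4\<close> is halved by
    \<open>one_plus_ge_exp\<close>.\<close>
  have "exp (G / 8) \<le> exp (real (f v) * (lam v / 2))"
    using lam_f_ge[OF v fm] by (simp add: algebra_simps)
  also have "\<dots> = exp (lam v / 2) ^ f v"
    by (rule exp_of_nat_mult)
  also have "\<dots> \<le> (1 + lam v) ^ f v"
    by (intro power_mono one_plus_ge_exp lam) auto
  also have "\<dots> \<le> p S v"
    unfolding p_def using ge lam by (intro power_increasing) auto
  also have "\<dots> \<le> sum (p S) V"
    using v finite_V p_nonneg[of _ S] by (intro member_le_sum) auto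
  finally have P: "exp (G / 8) \<le> sum (p S) V" .
  have "\<exists>u\<in>V. q S u \<noteq> 0"
    using c unfolding cand_def by (meson sum.neutral)
  then obtain u where u: "u \<in> V" and qu: "40 * hits E S u < g u"
    by (auto simp: q_def split: if_splits)
  have mu: "0 \<le> mu u" "mu u \<le> 1 / 2" using mu_nonneg[OF u] mu_le[OF u] by auto
  \<comment> \<open>With \<open>d\<close> the degree of \<open>u\<close>,
    \<open>40 * mu u * d \<le> G / 2\<close>, hence
    \<open>2 * mu u * d \<le> G / 40\<close>.\<close>
  have "mu u * (40 * real (hits E S u)) \<le> mu u * real (g u)"
    using qu mu by (intro mult_left_mono) auto
  then have "exp (- (G / 40)) \<le> exp (real (hits E S u) * (- (2 * mu u)))"
    using mu_g_le[OF u] by (simp add: algebra_simps)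
  also have "\<dots> = exp (- (2 * mu u)) ^ hits E S u"
    by (rule exp_of_nat_mult)
  also have "\<dots> \<le> (1 - mu u) ^ hits E S u"
    by (intro power_mono one_minus_ge_exp mu) auto
  also have "\<dots> = q S u" using qu by (simp add: q_def)
  also have "\<dots> \<le> sum (q S) V"
    using u finite_V q_nonneg[of _ S] by (intro member_le_sum) auto
  finally have Q: "exp (- (G / 40)) \<le> sum (q S) V" .
  \<comment> \<open>The exponent is \<open>G / 8 - 3 * G / 40\<close>. By \<open>G_large\<close> it
    exceeds \<open>4 * ln (card V)\<close>, against the invariant.\<close>
  have "exp (G / 20) = exp (G / 8) * exp (- (G / 40)) ^ 3"
    by (simp add: exp_of_nat_mult[symmetric] exp_add[symmetric])
  also have "\<dots> \<le> sum (p S) V * sum (q S) V ^ 3"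
    using P Q P_pos[OF V_nonempty, of S] by (intro mult_mono power_mono) auto
  also have "\<dots> \<le> real (card V) ^ 4" by (rule PQ)
  finally have "ln (exp (G / 20)) \<le> ln (real (card V) ^ 4)"
    using card_V_ge_1 by (subst ln_le_cancel_iff) auto
  then show False
    using G_large card_V_ge_1 by (simp add: ln_realpow)
qed

lemma good_empty: "good {}"
proof -
  have "sum (q {}) V \<le> (\<Sum>v\<in>V. 1)"
    by (intro sum_mono) (simp add: q_def hits_def)
  then have "sum (q {}) V ^ 3 \<le> real (card V) ^ 3"
    by (intro power_mono sum_nonneg q_nonneg) auto
  then have "real (card V) * sum (q {}) V ^ 3 \<le> real (card V) * real (card V) ^ 3"
    by (intro mult_left_mono) auto
  moreover have "sum (p {}) V = real (card V)"
    by (simp add: p_def hits_def)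
  ultimately show ?thesis
    by (simp add: good_def hits_def power4_eq_xxxx power3_eq_cube)
qed

lemma good_add_edge:
  assumes S: "good S" and e: "e < m"
  shows "good (add_edge S e)"
proof (cases "cand S e")
  case True
  have finS: "finite S" using S finite_subset by (auto simp: good_def)
  have eS: "e \<notin> S" using True by (simp add: cand_def)
  have "hits E (insert e S) v \<le> f v" if "v \<in> V" for v
    using hits_insert[OF finS eS, of E v] hits_less_upper[OF S e True that] by simp
  then show ?thesis
    using True S e potential_add_edge[OF finS e True] by (auto simp: add_edge_def good_def)
qed (use S in \<open>simp add: add_edge_def\<close>)

lemma good_foldl: "good S \<Longrightarrow> set xs \<subseteq> {..<m} \<Longrightarrow> good (foldl add_edge S xs)"
  by (induction xs arbitrary: S) (auto simp: good_add_edge)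

lemma good_pass: "good S \<Longrightarrow> good (pass S)"
  unfolding pass_def by (rule good_foldl) auto

lemma good_passes: "good ((pass ^^ t) {})"
  by (induction t) (auto simp: good_empty good_pass)

text \<open>A sweep that adds nothing has rejected every edge, so by \<open>exists_cand\<close> all
  vertices are saturated. Until then each sweep adds at least one edge.\<close>

lemma passes_progress: "sum (q ((pass ^^ t) {})) V = 0 \<or> t \<le> card ((pass ^^ t) {})"
proof (induction t)
  case (Suc t)
  let ?S = "(pass ^^ t) {}"
  have Sm: "?S \<subseteq> {..<m}" "pass ?S \<subseteq> {..<m}"
    using good_passes[of t] good_passes[of "Suc t"] by (auto simp: good_def)
  show ?case
  proof (cases "pass ?S = ?S")
    case True
    then have "\<not> cand ?S e" if "e < m" for e
      using foldl_fixed[of ?S "[0..<m]" e] Sm that by (auto simp: pass_def atLeast0LessThan)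
    then have "sum (q ?S) V = 0" using exists_cand[OF Sm(1)] by blast
    then show ?thesis using True by simp
  next
    case False
    moreover have "?S \<subseteq> pass ?S" using foldl_subset[of ?S "[0..<m]"] Sm by (simp add: pass_def atLeast0LessThan)
    moreover have fin: "finite (pass ?S)" using Sm(2) finite_subset by blast
    ultimately have less: "card ?S < card (pass ?S)" by (intro psubset_card_mono) auto
    show ?thesis
    proof (cases "sum (q ?S) V = 0")
      case True
      \<comment> \<open>Once everything is saturated no edge is a candidate, so the sweep cannot
        have changed the selection.\<close>
      then have "\<not> cand ?S e" for e by (simp add: cand_def)
      then have "foldl add_edge ?S xs = ?S" for xs
        by (induction xs) (auto simp: add_edge_def)
      with False show ?thesis by (simp add: pass_def)
    next
      case False
      with Suc less show ?thesis by auto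
    qed
  qed
qed simp

text \<open>Otherwise \<open>m\<close> sweeps have selected all \<open>m\<close> edges, and no edge
  is left to be the candidate that \<open>exists_cand\<close> provides.\<close>

lemma passes_saturate:
  assumes v: "v \<in> V"
  shows "g v \<le> 40 * hits E ((pass ^^ m) {}) v"
proof (rule ccontr)
  let ?S = "(pass ^^ m) {}"
  assume "\<not> g v \<le> 40 * hits E ?S v"
  then have "0 < q ?S v" using mu_le[OF v] by (simp add: q_def)
  also have "\<dots> \<le> sum (q ?S) V"
    using v finite_V q_nonneg[of _ ?S] by (intro member_le_sum) auto
  finally have Q: "sum (q ?S) V \<noteq> 0" by simp
  have Sm: "?S \<subseteq> {..<m}" using good_passes[of m] by (simp add: good_def)
  obtain e where e: "e < m" "cand ?S e" using exists_cand[OF Sm Q] by blast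
  have "m \<le> card ?S" using passes_progress[of m] Q by simp
  then have "?S = {..<m}" using Sm by (intro card_seteq) auto
  then show False using e by (auto simp: cand_def)
qed

lemma passes_upper: "v \<in> V \<Longrightarrow> hits E ((pass ^^ m) {}) v \<le> f v"
  using good_passes[of m] by (simp add: good_def)

end

section \<open>The program\<close>

abbreviation Var :: "nat \<Rightarrow> aexp" where
  "Var x \<equiv> Cell x (Num 0)"

text \<open>Scalars live in cell 0 of their bank: 2 holds the clamp \<open>N\<close>, 3 to 7 hold \<open>n\<close>, \<open>m\<close>, \<open>min k n\<close>, \<open>R\<close>
  and \<open>R ^ m\<close>, 8 holds \<open>G\<close>, 15 and 16 hold \<open>P\<close> and \<open>Q\<close>, and 18 and 19 the increments of \<open>P\<close> and \<open>Q\<close>.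
  Banks 10, 11, 12, 21, 22 are indexed by vertex names: the remaining demand \<open>g - 40 d\<close>, the two
  rounded factors, and the two weights. If there is no hyperedge, \<open>k\<close> may be exponential in the
  input size, hence the loop bound \<open>min k n\<close>.\<close>

definition vertex :: "nat \<Rightarrow> aexp" where
  "vertex j = Cell 0 (Add (Num 3) (Var j))"

definition lower :: "nat \<Rightarrow> aexp" where
  "lower j = Cell 0 (Add (Add (Num 3) (Var 3)) (Var j))"

definition upper :: "nat \<Rightarrow> aexp" where
  "upper j = Cell 0 (Add (Add (Num 3) (Mul (Num 2) (Var 3))) (Var j))"

text \<open>Bank 14 holds the edge and bank 20 the position in it. The stride \<open>min k n\<close>
  agrees with \<open>k\<close> as soon as there is an edge.\<close>

definition member :: aexp where
  "member = Cell 0 (Add (Add (Num 3) (Mul (Num 3) (Var 3))) (Add (Mul (Var 5) (Var 14)) (Var 20)))"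

text \<open>A plain \<open>com\<close>, because the truncation level in bank 2 is only set by its
  last instruction. Here and below, \<open>a - (a - b)\<close> computes
  \<open>min a b\<close>.\<close>

definition prelude :: com where
  "prelude = Seq (Store 3 (Num 0) (Cell 0 (Num 1)))
    (Seq (Store 4 (Num 0) (Cell 0 (Num 2)))
    (Seq (Store 5 (Num 0) (Sub (Cell 0 (Num 0)) (Sub (Cell 0 (Num 0)) (Var 3))))
    (Seq (Store 6 (Num 0) (Mul (Num 2) (Add (Add (Var 3) (Var 4)) (Num 1))))
    (Seq (Store 7 (Num 0) (Num 1))
    (Seq (for_loop 13 4 (Store 7 (Num 0) (Mul (Var 7) (Var 6))))
    (Store 2 (Num 0) (Mul (Mul (Var 7) (Var 7)) (Mul (Var 6) (Var 6)))))))))"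

definition prelude_factor :: nat where
  "prelude_factor = (3 + cost_factor (Cell 0 (Num 1))) + (3 + cost_factor (Cell 0 (Num 2))) +
     (3 + cost_factor (Sub (Cell 0 (Num 0)) (Sub (Cell 0 (Num 0)) (Var 3)))) +
     (3 + cost_factor (Mul (Num 2) (Add (Add (Var 3) (Var 4)) (Num 1)))) +
     (3 + cost_factor (Num 1)) + (3 + cost_factor (Mul (Var 7) (Var 6)) + 40) +
     (3 + cost_factor (Mul (Mul (Var 7) (Var 7)) (Mul (Var 6) (Var 6))))"

text \<open>\<open>N\<close> plays the part of infinity as the starting value of the
  minimum.\<close>

definition min_lower :: prog where
  "min_lower = Asg 8 (Num 0) (Var 2) ;;
     For 9 3 (Asg 8 (Num 0) (Sub (Var 8) (Sub (Var 8) (lower 9))))"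

definition weights :: prog where
  "weights = For 23 3
    (Asg 10 (vertex 23) (lower 23) ;;
     Asg 11 (vertex 23) (Quot (Mul (Var 6) (Var 8)) (Mul (Num 2) (upper 23))) ;;
     Asg 12 (vertex 23) (Quot (Mul (Var 6) (Var 8)) (Mul (Num 2) (lower 23))) ;;
     Asg 21 (vertex 23) (Var 7) ;;
     Asg 22 (vertex 23) (Var 7))"

definition totals :: prog where
  "totals = Asg 15 (Num 0) (Num 0) ;; Asg 16 (Num 0) (Num 0) ;;
     For 17 3
      (Asg 15 (Num 0) (Add (Var 15) (Cell 21 (vertex 17))) ;;
       Asg 16 (Num 0) (Add (Var 16) (Cell 22 (vertex 17))))"

definition scores :: prog where
  "scores = Asg 18 (Num 0) (Num 0) ;; Asg 19 (Num 0) (Num 0) ;;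
     For 20 5
      (Asg 18 (Num 0) (Add (Var 18) (Mul (Cell 21 member) (Cell 11 member))) ;;
       Asg 19 (Num 0) (Add (Var 19) (Mul (Cell 22 member) (Cell 12 member))))"

text \<open>A product with one factor for each condition of \<open>cand\<close>. With truncated
  subtraction \<open>1 + x - y\<close> is nonzero iff \<open>y \<le> x\<close>. Being a condition
  and not an assignment, it is not cut off at \<open>N\<close>.\<close>

definition test :: aexp where
  "test = Mul (Sub (Num 1) (Cell 1 (Var 14))) (Mul (Var 16)
     (Sub (Add (Num 1) (Mul (Num 3) (Mul (Var 19) (Var 15)))) (Mul (Var 18) (Var 16))))"

text \<open>Dividing by \<open>R\<close> and multiplying by \<open>R + l v\<close> or
  \<open>R - h v\<close> exchanges one factor of a weight. \<open>1 - (1 - x)\<close> is the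
  indicator of \<open>x > 0\<close>; it reads the demand just updated, so a newly saturated vertex
  gets weight 0.\<close>

definition advance :: prog where
  "advance = Asg 1 (Var 14) (Num 1) ;;
     For 20 5
      (Asg 10 member (Sub (Cell 10 member) (Num 40)) ;;
       Asg 21 member (Mul (Quot (Cell 21 member) (Var 6)) (Add (Var 6) (Cell 11 member))) ;;
       Asg 22 member (Mul (Sub (Num 1) (Sub (Num 1) (Cell 10 member)))
         (Mul (Quot (Cell 22 member) (Var 6)) (Sub (Var 6) (Cell 12 member)))))"

definition try_edge :: prog where
  "try_edge = totals ;; scores ;; When test advance"

definition main :: prog where
  "main = min_lower ;; weights ;; For 13 4 (For 14 4 try_edge)"

lemmas prog_defs = main_def try_edge_def min_lower_def weights_def totals_def scores_def advance_def

lemma main_safe: "safe main" "writes main \<inter> {2, 3, 4, 5} = {}"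
  by (simp_all add: prog_defs)

section \<open>Layout of the input, size parameters and initialization\<close>

lemma concat_nth_uniform:
  assumes "\<And>e. e \<in> set es \<Longrightarrow> length e = k" "e < length es" "i < k"
  shows "k * e + i < length (concat es) \<and> concat es ! (k * e + i) = es ! e ! i"
  using assms
proof (induction es arbitrary: e)
  case (Cons a es)
  have la: "length a = k" using Cons.prems by simp
  show ?case
  proof (cases e)
    case 0
    then show ?thesis using la Cons.prems by (simp add: nth_append)
  next
    case (Suc e')
    then show ?thesis
      using Cons.IH[of e'] Cons.prems la by (simp add: nth_append)
  qed
qed simp

text \<open>The setting of the time bound, which covers infeasible instances too; hence nothing is
  assumed about \<open>g\<close> and \<open>f\<close>.\<close>

locale graph_input =
  fixes k :: nat and vs :: "nat list" and es :: "nat list list" and g f :: "nat \<Rightarrow> nat"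
  assumes distinct_vs: "distinct vs"
    and edge: "e \<in> set es \<Longrightarrow> distinct e \<and> set e \<subseteq> set vs \<and> length e = k"
    and k_pos: "0 < k"
begin

definition n :: nat where "n = length vs"
definition m :: nat where "m = length es"
text \<open>\<open>2 * m \<le> R\<close> makes rounding lose at most a factor 2, and
  \<open>n \<le> R\<close> lets a sum over vertices gain at most a factor \<open>R\<close>. The
  exponent in \<open>N\<close> leaves \<open>2 * m\<close> for a weight, 1 for a factor
  \<open>l v\<close> or \<open>h v\<close>, and 1 for a summation.\<close>

definition R :: nat where "R = 2 * (n + m + 1)"
definition N :: nat where "N = R ^ (2 * m + 2)"
definition input :: "nat list" where "input = encode k vs es g f"

definition ready :: "memory \<Rightarrow> bool" where
  "ready s \<longleftrightarrow> s 0 = init input 0 \<and> s 2 0 = N \<and> s 3 0 = n \<and> s 4 0 = m \<and> s 5 0 = min k n \<and>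
     s 6 0 = R \<and> s 7 0 = R ^ m"

lemma init_input:
  "init input 0 0 = k" "init input 0 (Suc 0) = n" "init input 0 2 = m"
  "j < n \<Longrightarrow> init input 0 (3 + j) = vs ! j"
  "j < n \<Longrightarrow> init input 0 (3 + n + j) = g (vs ! j)"
  "j < n \<Longrightarrow> init input 0 (3 + 2 * n + j) = f (vs ! j)"
  by (simp_all add: init_def input_def encode_def n_def m_def nth_append)

lemma init_input_edge:
  assumes "e < m" "i < k"
  shows "init input 0 (3 + 3 * n + (k * e + i)) = es ! e ! i"
  using concat_nth_uniform[of es k e i] assms edge
  by (simp add: init_def input_def encode_def n_def m_def nth_append)

text \<open>Each edge fills \<open>k \<ge> 1\<close> cells of the code and each cell has length at
  least 1. So loops up to \<open>n\<close> and \<open>m\<close> are polynomial.\<close>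

lemma input_size_ge: "n + m \<le> input_size input"
proof -
  have "length (concat es) = (\<Sum>e\<leftarrow>es. k)"
    unfolding length_concat using edge by (intro arg_cong[where f = sum_list] map_cong refl) auto
  then have "m \<le> length (concat es)"
    using k_pos by (simp add: sum_list_triv m_def)
  then have "n + m \<le> length input" by (simp add: input_def encode_def n_def)
  also have "length input = (\<Sum>x\<leftarrow>input. 1)" by (simp add: sum_list_triv)
  also have "\<dots> \<le> input_size input"
    unfolding input_size_def using len_pos by (intro sum_list_mono) (simp add: Suc_le_eq)
  finally show ?thesis .
qed

lemma R_ge_2: "2 \<le> R"
  by (simp add: R_def)

lemma R_power_mono: "i \<le> j \<Longrightarrow> R ^ i \<le> R ^ j"
  using R_ge_2 by (intro power_increasing) auto

lemma R_power_le_N: "i \<le> 2 * m + 2 \<Longrightarrow> R ^ i \<le> N"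
  unfolding N_def by (rule R_power_mono)

lemma R_le_N: "R \<le> N"
  using R_power_le_N[of 1] by simp

text \<open>Not \<open>len N\<close> alone, because entries of the input such as \<open>f v\<close>
  may exceed \<open>N\<close>.\<close>

definition width :: nat where "width = input_size input + len N"

lemma len_width: "a \<le> N \<Longrightarrow> len a \<le> width"
  unfolding width_def using len_mono[of a N] by simp

lemma bounded_init: "bounded_mem width (init input)"
proof -
  have "len (init input x i) \<le> width" for x i
  proof (cases "x = 0 \<and> i < length input")
    case True
    then have "len (input ! i) \<le> input_size input"
      unfolding input_size_def by (intro member_le_sum_list) auto
    then show ?thesis using True by (simp add: init_def width_def)
  next
    case False
    then show ?thesis using len_width[of 0] by (auto simp: init_def)
  qed
  then show ?thesis by (simp add: bounded_mem_def)
qed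

text \<open>\<open>N\<close> is exponential but has polynomially many digits. The crude
  \<open>len R \<le> R + 1\<close> suffices, as \<open>R\<close> is linear in
  \<open>n + m\<close>.\<close>

lemma width_le:
  assumes "input_size input \<le> z"
  shows "width \<le> z + ((2 * z + 2) * (2 * z + 3) + 2)"
proof -
  have "len N \<le> (2 * m + 2) * len R + 2"
    unfolding N_def by (rule len_power)
  also have "\<dots> \<le> (2 * z + 2) * (2 * z + 3) + 2"
    using len_le_Suc[of R] input_size_ge assms by (intro add_mono mult_mono) (auto simp: R_def)
  finally show ?thesis using assms by (simp add: width_def)
qed

lemma runs_Store_width:
  assumes "bounded_mem width s" "aval b s \<le> N"
  shows "runs (Store x (Num 0) b) s (store s x 0 (aval b s)) ((3 + cost_factor b) * width)"
    "bounded_mem width (store s x 0 (aval b s))"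
proof -
  have W: "0 < width" using assms(1) by (rule bounded_mem_pos)
  have "len 0 = 1" by (simp add: len_def floorlog_def)
  then show "runs (Store x (Num 0) b) s (store s x 0 (aval b s)) ((3 + cost_factor b) * width)"
    using runs_Store[of x "Num 0" b s] acost_le[OF assms(1), of b] W
    by (auto elim!: runs_mono simp: algebra_simps)
  show "bounded_mem width (store s x 0 (aval b s))"
    using assms len_width by (intro bounded_mem_store)
qed

lemma prelude_runs:
  "\<exists>s. runs prelude (init input) s (prelude_factor * (m + 1) * width) \<and> bounded_mem width s \<and>
     ready s \<and> s 1 = (\<lambda>_. 0)"
proof -
  let ?b1 = "Cell 0 (Num 1)" and ?b2 = "Cell 0 (Num 2)"
    and ?b3 = "Sub (Cell 0 (Num 0)) (Sub (Cell 0 (Num 0)) (Var 3))"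
    and ?b4 = "Mul (Num 2) (Add (Add (Var 3) (Var 4)) (Num 1))"
    and ?b6 = "Mul (Var 7) (Var 6)" and ?b7 = "Mul (Mul (Var 7) (Var 7)) (Mul (Var 6) (Var 6))"
  have le_N: "n \<le> N" "m \<le> N" "min k n \<le> N" "1 \<le> N"
    using R_le_N R_ge_2 by (auto simp: R_def)
  define s1 where "s1 = store (init input) 3 0 n"
  define s2 where "s2 = store s1 4 0 m"
  define s3 where "s3 = store s2 5 0 (min k n)"
  define s4 where "s4 = store s3 6 0 R"
  define s5 where "s5 = store s4 7 0 1"
  \<comment> \<open>The memory after \<open>i\<close> rounds of the loop that computes
    \<open>R ^ m\<close>.\<close>
  define st where "st i = store (store s5 7 0 (R ^ i)) 13 0 i" for i
  define s7 where "s7 = store (st m) 2 0 N"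
  note s_defs = s7_def st_def s5_def s4_def s3_def s2_def s1_def
  have v1: "aval ?b1 (init input) = n" by (simp add: init_input)
  have v2: "aval ?b2 s1 = m" by (simp add: s_defs store_def init_input)
  have v3: "aval ?b3 s2 = min k n"
    by (simp add: s_defs store_def init_input)
  have v4: "aval ?b4 s3 = R" by (simp add: s_defs store_def R_def)
  have v7: "aval ?b7 (st m) = N"
    by (simp add: s_defs store_def N_def power_add power2_eq_square mult_2)
  have r1: "runs (Store 3 (Num 0) ?b1) (init input) s1 ((3 + cost_factor ?b1) * width)"
    "bounded_mem width s1"
    using runs_Store_width[OF bounded_init, of ?b1 3] le_N unfolding v1 s1_def by auto
  have r2: "runs (Store 4 (Num 0) ?b2) s1 s2 ((3 + cost_factor ?b2) * width)"
    "bounded_mem width s2"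
    using runs_Store_width[OF r1(2), of ?b2 4] le_N unfolding v2 s2_def by auto
  have r3: "runs (Store 5 (Num 0) ?b3) s2 s3 ((3 + cost_factor ?b3) * width)"
    "bounded_mem width s3"
    using runs_Store_width[OF r2(2), of ?b3 5] le_N unfolding v3 s3_def by auto
  have r4: "runs (Store 6 (Num 0) ?b4) s3 s4 ((3 + cost_factor ?b4) * width)"
    "bounded_mem width s4"
    using runs_Store_width[OF r3(2), of ?b4 6] R_le_N unfolding v4 s4_def by auto
  have r5: "runs (Store 7 (Num 0) (Num 1)) s4 s5 ((3 + cost_factor (Num 1)) * width)"
    "bounded_mem width s5"
    using runs_Store_width[OF r4(2), of "Num 1" 7] le_N unfolding s5_def by auto
  define h where "h s = store s 7 0 (s 7 0 * s 6 0)" for s :: memory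
  have iter: "(for_step 13 h ^^ i) (store s5 13 0 0) = st i" for i
  proof (induction i)
    case 0
    then show ?case by (auto simp: s_defs store_def fun_eq_iff)
  next
    case (Suc i)
    have "for_step 13 h (st i) = st (Suc i)"
      by (auto simp: s_defs h_def for_step_def store_def fun_eq_iff)
    then show ?case using Suc by simp
  qed
  have small: "R ^ i \<le> N" "i \<le> N" if "i \<le> m + 2" for i
    using that R_power_le_N[of i] R_le_N by (auto simp: R_def)
  have bst: "bounded_mem width (st i)" if "i \<le> m" for i
    unfolding st_def using that small len_width by (intro bounded_mem_store r5(2)) auto
  have h_val: "aval ?b6 (st i) = R ^ Suc i" for i
    by (simp add: s_defs store_def)
  have h_eq: "h (st i) = store (st i) 7 0 (aval ?b6 (st i))" for i
    by (simp add: h_def)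
  have body: "runs (Store 7 (Num 0) ?b6) (st i) (h (st i)) ((3 + cost_factor ?b6) * width)"
    "bounded_mem width (h (st i))" if "i < m" for i
    using runs_Store_width[OF bst, of i ?b6 7] small(1)[of "Suc i"] that
    unfolding h_eq h_val by auto
  have fix7: "st i x 0 = h (st i) x 0" if "x \<noteq> 7" for i x
    using that by (simp add: h_def store_def)
  have "s5 4 0 = m" by (simp add: s_defs store_def)
  then have r6: "runs (for_loop 13 4 (Store 7 (Num 0) ?b6)) s5 (st m)
      ((m + 1) * ((3 + cost_factor ?b6) * width + 40 * width))"
    using runs_for_loop[of s5 4 m 13 width "Store 7 (Num 0) ?b6" h "(3 + cost_factor ?b6) * width",
        unfolded iter] r5(2) body fix7 by simp
  have r7: "runs (Store 2 (Num 0) ?b7) (st m) s7 ((3 + cost_factor ?b7) * width)"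
    "bounded_mem width s7"
    using runs_Store_width[OF bst, of m ?b7 2] unfolding v7 s7_def by auto
  note run = runs_Seq[OF r1(1) runs_Seq[OF r2(1) runs_Seq[OF r3(1) runs_Seq[OF r4(1)
    runs_Seq[OF r5(1) runs_Seq[OF r6 r7(1)]]]]], folded prelude_def]
  have total: "a1 * width + (a2 * width + (a3 * width + (a4 * width + (a5 * width +
      ((m + 1) * (a6 * width + 40 * width) + a7 * width)))))
      \<le> (a1 + a2 + a3 + a4 + a5 + (a6 + 40) + a7) * (m + 1) * width" for a1 a2 a3 a4 a5 a6 a7
    by (simp add: algebra_simps)
  have "runs prelude (init input) s7 (prelude_factor * (m + 1) * width)"
    unfolding prelude_factor_def by (rule runs_mono[OF run total])
  moreover have "ready s7" "s7 1 = (\<lambda>_. 0)"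
    by (auto simp: ready_def s_defs store_def init_def)
  ultimately show ?thesis using r7(2) by blast
qed

lemma ready_frame:
  assumes "ready s" "writes p \<inter> {0, 2, 3, 4, 5, 6, 7} = {}"
  shows "ready (sem p s)"
  using assms by (auto simp: ready_def sem_frame)

end

section \<open>Running time\<close>

lemma store_apply: "store s x i v y = (if y = x then (s x)(i := v) else s y)"
  by (simp add: store_def)

text \<open>Rounding down a quotient that is at least 1 loses less than half: the remainder is below
  \<open>y\<close>, hence below \<open>x div y * y\<close>.\<close>

lemma twice_div_mult_ge:
  fixes x y :: nat
  assumes "y \<le> x" "0 < y"
  shows "x \<le> 2 * (x div y * y)"
proof -
  have "1 * y \<le> x div y * y"
    using assms by (intro mult_le_mono1) (simp add: Suc_le_eq div_greater_zero_iff)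
  moreover have "x mod y < y" using assms by simp
  ultimately show ?thesis using div_mult_mod_eq[of x y] by linarith
qed

definition algorithm :: com where
  "algorithm = Seq prelude (compile main)"

text \<open>At input size \<open>z\<close> the first factor is \<open>prelude_factor * (z + 1) +
  prog_factor main * (z + 1) ^ depth main\<close>; the second is the bound of
  \<open>width_le\<close>.\<close>

definition time_bound :: "nat poly" where
  "time_bound = ([:prelude_factor:] * [:1, 1:] + [:prog_factor main:] * [:1, 1:] ^ depth main) *
     ([:0, 1:] + ([:2, 2:] * [:3, 2:] + [:2:]))"

context graph_input
begin

lemma algorithm_runs:
  "\<exists>s. ready s \<and> s 1 = (\<lambda>_. 0) \<and>
     runs algorithm (init input) (sem main s) (poly time_bound (input_size input))"
proof -
  let ?z = "input_size input"
  obtain s where pre: "runs prelude (init input) s (prelude_factor * (m + 1) * width)"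
    and bs: "bounded_mem width s" and rs: "ready s" and s1: "s 1 = (\<lambda>_. 0)"
    using prelude_runs by blast
  have T: "\<forall>y\<in>{3, 4, 5}. s y 0 \<le> ?z"
    using rs input_size_ge by (auto simp: ready_def)
  have "runs (compile main) s (sem main s) (prog_factor main * (?z + 1) ^ depth main * width)"
    using runs_compile[OF main_safe bs T] by simp
  from runs_Seq[OF pre this]
  have run: "runs algorithm (init input) (sem main s)
      (prelude_factor * (m + 1) * width + prog_factor main * (?z + 1) ^ depth main * width)"
    unfolding algorithm_def .
  have "prelude_factor * (m + 1) * width + prog_factor main * (?z + 1) ^ depth main * width
      \<le> prelude_factor * (?z + 1) * width + prog_factor main * (?z + 1) ^ depth main * width"
    using input_size_ge by (intro add_mono mult_mono) auto
  also have "\<dots> = (prelude_factor * (?z + 1) + prog_factor main * (?z + 1) ^ depth main) * width"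
    by (simp add: algebra_simps)
  also have "\<dots> \<le> (prelude_factor * (?z + 1) + prog_factor main * (?z + 1) ^ depth main) *
      (?z + ((2 * ?z + 2) * (2 * ?z + 3) + 2))"
    by (intro mult_left_mono width_le) auto
  also have "\<dots> = poly time_bound ?z"
    by (simp add: time_bound_def poly_power algebra_simps)
  finally show ?thesis using runs_mono[OF run] rs s1 by blast
qed

lemma ready_store [simp]: "x \<notin> {0, 2, 3, 4, 5, 6, 7} \<Longrightarrow> ready (store s x i v) = ready s"
  by (auto simp: ready_def store_apply)

lemma ready_cells:
  assumes "ready s"
  shows "s 2 0 = N" "s 3 0 = n" "s 4 0 = m" "s 5 0 = min k n" "s 6 0 = R" "s 7 0 = R ^ m"
  using assms by (auto simp: ready_def)

lemma aval_input:
  assumes "ready s" "s x 0 < n"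
  shows "aval (vertex x) s = vs ! s x 0" "aval (lower x) s = g (vs ! s x 0)"
    "aval (upper x) s = f (vs ! s x 0)"
  using assms init_input by (auto simp: vertex_def lower_def upper_def ready_def)

text \<open>An edge has \<open>k\<close> distinct vertices, so \<open>min k n\<close> is
  \<open>k\<close> whenever an edge is examined.\<close>

lemma k_le_n:
  assumes "e < m"
  shows "k \<le> n"
proof -
  have "k = card (set (es ! e))" using edge[of "es ! e"] assms by (simp add: m_def distinct_card)
  also have "\<dots> \<le> card (set vs)" using edge[of "es ! e"] assms by (intro card_mono) (auto simp: m_def)
  finally show ?thesis using distinct_vs by (simp add: distinct_card n_def)
qed

lemma aval_member:
  assumes "ready s" "s 14 0 < m" "s 20 0 < k"
  shows "aval member s = es ! s 14 0 ! s 20 0"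
  using assms init_input_edge[of "s 14 0" "s 20 0"] k_le_n[of "s 14 0"]
  by (auto simp: member_def ready_def)

lemma sum_vertices: "(\<Sum>j<n. w (vs ! j)) = sum w (set vs)"
  using distinct_vs by (intro sum.reindex_bij_betw bij_betw_nth) (auto simp: n_def)

lemma sum_members:
  assumes "e < m"
  shows "(\<Sum>i<k. w (es ! e ! i)) = sum w (set (es ! e))"
  using edge[of "es ! e"] assms by (intro sum.reindex_bij_betw bij_betw_nth) (auto simp: m_def)

end

section \<open>Correctness of the program\<close>

locale feasible_input = graph_input +
  fixes J :: "nat set" and G :: nat
  assumes vs_nonempty: "vs \<noteq> []" and G_eq: "G = Min (g ` set vs)" and G_pos: "0 < G"
    and G_large: "80 * ln (real (card (set vs))) < real G"
    and lower_le_upper: "v \<in> set vs \<Longrightarrow> g v \<le> f v"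
    and J_sub: "J \<subseteq> {..<length es}"
    and J_lower: "v \<in> set vs \<Longrightarrow> g v \<le> hits (\<lambda>j. set (es ! j)) J v"
    and J_upper: "v \<in> set vs \<Longrightarrow> hits (\<lambda>j. set (es ! j)) J v \<le> f v"
begin

abbreviation V :: "nat set" where "V \<equiv> set vs"

definition E :: "nat \<Rightarrow> nat set" where "E j = set (es ! j)"
text \<open>\<open>l v / R\<close> and \<open>h v / R\<close> will serve as \<open>lam v\<close> and
  \<open>mu v\<close>.\<close>

definition l :: "nat \<Rightarrow> nat" where "l v = R * G div (2 * f v)"
definition h :: "nat \<Rightarrow> nat" where "h v = R * G div (2 * g v)"

lemma n_pos: "0 < n"
  using vs_nonempty by (simp add: n_def)

lemma vs_nth: "j < n \<Longrightarrow> vs ! j \<in> V"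
  by (simp add: n_def)

lemma G_le: "v \<in> V \<Longrightarrow> G \<le> g v"
  unfolding G_eq by (rule Min_le) auto

text \<open>The feasible solution has at most \<open>m\<close> edges. Hence \<open>h v\<close> does
  not round to 0 and demands escape the truncation, whereas \<open>f v\<close> may be arbitrarily
  large.\<close>

lemma g_le_m:
  assumes "v \<in> V"
  shows "g v \<le> m"
proof -
  have fin: "finite J" using J_sub finite_subset by blast
  have "g v \<le> card J" using J_lower[OF assms] hits_le_card[OF fin] by (rule le_trans)
  also have "\<dots> \<le> m" using card_mono[OF _ J_sub] by (simp add: m_def)
  finally show ?thesis .
qed

lemma l_f_le: "l v * (2 * f v) \<le> R * G"
  unfolding l_def by (rule div_times_less_eq_dividend)

lemma h_g_le: "h v * (2 * g v) \<le> R * G"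
  unfolding h_def by (rule div_times_less_eq_dividend)

lemma twice_l_le: "v \<in> V \<Longrightarrow> 2 * l v \<le> R"
proof -
  assume v: "v \<in> V"
  have f: "G \<le> f v" "0 < f v" using G_le[OF v] lower_le_upper[OF v] G_pos by auto
  have "l v * (2 * f v) \<le> R * f v" using l_f_le[of v] mult_le_mono2[OF f(1)] by (rule le_trans)
  then have "(2 * l v) * f v \<le> R * f v" by (simp only: ac_simps)
  then show ?thesis using f(2) by simp
qed

lemma twice_h_le: "v \<in> V \<Longrightarrow> 2 * h v \<le> R"
proof -
  assume v: "v \<in> V"
  have g: "G \<le> g v" "0 < g v" using G_le[OF v] G_pos by auto
  have "h v * (2 * g v) \<le> R * g v" using h_g_le[of v] mult_le_mono2[OF g(1)] by (rule le_trans)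
  then have "(2 * h v) * g v \<le> R * g v" by (simp only: ac_simps)
  then show ?thesis using g(2) by simp
qed

lemma R_le_RG: "R \<le> R * G"
  using G_pos by simp

text \<open>For \<open>f v > m\<close> the quotient \<open>l v\<close> may round to 0, but a degree
  above \<open>m\<close> is never reached.\<close>

lemma l_f_ge:
  assumes "v \<in> V" "f v \<le> m"
  shows "R * G \<le> 4 * (l v * f v)"
proof -
  have "0 < f v" using G_le[OF assms(1)] lower_le_upper[OF assms(1)] G_pos by simp
  then show ?thesis
    using twice_div_mult_ge[of "2 * f v" "R * G"] assms R_le_RG by (simp add: l_def R_def)
qed

lemma h_g_ge:
  assumes "v \<in> V"
  shows "R * G \<le> 4 * (h v * g v)"
proof -
  have "0 < g v" using G_le[OF assms] G_pos by simp
  then show ?thesis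
    using twice_div_mult_ge[of "2 * g v" "R * G"] g_le_m[OF assms] R_le_RG by (simp add: h_def R_def)
qed

lemma R_pos: "0 < R"
  using R_ge_2 by simp

sublocale greedy: feasible_greedy V E m g f "\<lambda>v. real (l v) / real R" "\<lambda>v. real (h v) / real R" "real G" J
proof
  fix v assume v: "v \<in> V"
  have lr: "2 * real (l v) \<le> real R" "2 * real (h v) \<le> real R"
    using twice_l_le[OF v] twice_h_le[OF v] by linarith+
  then show "real (l v) / real R \<le> 1" "real (h v) / real R \<le> 1 / 2"
    using R_pos by (simp_all add: field_simps)
  have "real (l v * (2 * f v)) \<le> real (R * G)" "real (h v * (2 * g v)) \<le> real (R * G)"
    using l_f_le[of v] h_g_le[of v] by (simp_all only: of_nat_le_iff)
  then show "real (l v) / real R * real (f v) \<le> real G / 2"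
    "real (h v) / real R * real (g v) \<le> real G / 2"
    using R_pos by (simp_all add: field_simps)
  have "real (R * G) \<le> real (4 * (h v * g v))"
    using h_g_ge[OF v] by (simp only: of_nat_le_iff)
  then show "real G / 4 \<le> real (h v) / real R * real (g v)"
    using R_pos by (simp add: field_simps)
  show "real G / 4 \<le> real (l v) / real R * real (f v)" if "f v \<le> m"
  proof -
    have "real (R * G) \<le> real (4 * (l v * f v))"
      using l_f_ge[OF v that] by (simp only: of_nat_le_iff)
    then show ?thesis using R_pos by (simp add: field_simps)
  qed
qed (use G_large J_sub J_lower J_upper vs_nonempty edge in \<open>auto simp: E_def[abs_def] m_def\<close>)

lemma sem_min_lower:
  assumes s: "ready s"
  shows "sem min_lower s 8 0 = G"
proof -
  let ?p = "Asg 8 (Num 0) (Sub (Var 8) (Sub (Var 8) (lower 9)))"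
  let ?s = "store s 8 0 N"
  have rs: "ready ?s" using s by simp
  have "(\<forall>j<n. sem (For 9 3 ?p) ?s 8 0 \<le> g (vs ! j)) \<and> (sem (For 9 3 ?p) ?s 8 0 = N \<or>
      (\<exists>j<n. sem (For 9 3 ?p) ?s 8 0 = g (vs ! j)))"
  proof (rule For_rule[where n = n and I = "\<lambda>i s'. (\<forall>j<i. s' 8 0 \<le> g (vs ! j)) \<and>
      (s' 8 0 = N \<or> (\<exists>j<i. s' 8 0 = g (vs ! j)))"])
    fix i s'
    assume i: "i < n" and I: "(\<forall>j<i. s' 8 0 \<le> g (vs ! j)) \<and>
      (s' 8 0 = N \<or> (\<exists>j<i. s' 8 0 = g (vs ! j)))" and c: "s' 9 0 = i"
      and fr: "\<And>z. z \<notin> writes ?p \<Longrightarrow> z \<noteq> 9 \<Longrightarrow> s' z = ?s z"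
    have rs': "ready s'" using rs fr by (auto simp: ready_def)
    \<comment> \<open>The running minimum never exceeds \<open>N\<close>, so truncation does not
      alter it.\<close>
    have le: "s' 8 0 \<le> N"
      using I i g_le_m[OF vs_nth] R_le_N by (fastforce simp: R_def)
    have eq: "store (sem ?p s') 9 0 (Suc i) 8 0 = min (s' 8 0) (g (vs ! i))"
      using aval_input(2)[OF rs', of 9] c i ready_cells[OF rs'] le by (simp add: store_apply)
    show "(\<forall>j<Suc i. store (sem ?p s') 9 0 (Suc i) 8 0 \<le> g (vs ! j)) \<and>
      (store (sem ?p s') 9 0 (Suc i) 8 0 = N \<or>
        (\<exists>j<Suc i. store (sem ?p s') 9 0 (Suc i) 8 0 = g (vs ! j)))"
      unfolding eq using I by (auto simp: less_Suc_eq min_def)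
  qed (use s in \<open>auto simp: ready_cells store_apply\<close>)
  moreover have "sem min_lower s = sem (For 9 3 ?p) ?s"
    using s by (simp add: min_lower_def ready_cells)
  ultimately have *: "\<forall>j<n. sem min_lower s 8 0 \<le> g (vs ! j)"
    "sem min_lower s 8 0 = N \<or> (\<exists>j<n. sem min_lower s 8 0 = g (vs ! j))"
    by auto
  \<comment> \<open>This excludes that the result is still the starting value
    \<open>N\<close>.\<close>
  have "g (vs ! 0) < N"
    using g_le_m[OF vs_nth[OF n_pos]] R_le_N by (simp add: R_def)
  then obtain j where j: "j < n" "sem min_lower s 8 0 = g (vs ! j)"
    using * n_pos by fastforce
  have "sem min_lower s 8 0 \<le> g v" if "v \<in> V" for v
    using * that by (auto simp: in_set_conv_nth n_def)
  then show ?thesis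
    unfolding G_eq j(2) using j(1) by (intro Min_eqI[symmetric]) (auto simp: n_def)
qed

section \<open>Integer weights and the memory invariant\<close>

definition pn :: "nat set \<Rightarrow> nat \<Rightarrow> nat" where
  "pn S v = R ^ (m - hits E S v) * (R + l v) ^ hits E S v"

definition qn :: "nat set \<Rightarrow> nat \<Rightarrow> nat" where
  "qn S v = (if 40 * hits E S v < g v then R ^ (m - hits E S v) * (R - h v) ^ hits E S v else 0)"

definition represents :: "nat set \<Rightarrow> memory \<Rightarrow> bool" where
  "represents S s \<longleftrightarrow> ready s \<and> (\<forall>e<m. s 1 e = of_bool (e \<in> S)) \<and>
     (\<forall>v\<in>V. s 10 v = g v - 40 * hits E S v \<and> s 11 v = l v \<and> s 12 v = h v \<and>
       s 21 v = pn S v \<and> s 22 v = qn S v)"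

lemma represents_frame:
  assumes "represents S s" "\<And>x. x \<in> {0, 1, 2, 3, 4, 5, 6, 7, 10, 11, 12, 21, 22} \<Longrightarrow> s' x = s x"
  shows "represents S s'"
  using assms by (simp add: represents_def ready_def)

lemma hits_le_m: "S \<subseteq> {..<m} \<Longrightarrow> hits E S v \<le> m"
  using hits_le_card[of S E v] card_mono[of "{..<m}" S] finite_subset[of S "{..<m}"] by simp

lemma pn_le:
  assumes "v \<in> V" "S \<subseteq> {..<m}"
  shows "pn S v \<le> R ^ (2 * m)"
proof -
  have "R + l v \<le> R * R"
    using twice_l_le[OF assms(1)] mult_le_mono1[OF R_ge_2, of R] by linarith
  then have "pn S v \<le> R ^ (m - hits E S v) * (R * R) ^ hits E S v"
    unfolding pn_def by (intro mult_left_mono power_mono) auto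
  also have "\<dots> = R ^ (m - hits E S v + 2 * hits E S v)"
    by (simp add: power_add power_mult power2_eq_square)
  also have "\<dots> \<le> R ^ (2 * m)"
    using hits_le_m[OF assms(2), of v] by (intro R_power_mono) simp
  finally show ?thesis .
qed

lemma qn_le:
  assumes "S \<subseteq> {..<m}"
  shows "qn S v \<le> R ^ (2 * m)"
proof -
  have "qn S v \<le> R ^ (m - hits E S v) * R ^ hits E S v"
    unfolding qn_def by (auto intro!: mult_left_mono power_mono)
  also have "\<dots> = R ^ m"
    using hits_le_m[OF assms, of v] by (simp add: power_add[symmetric])
  also have "\<dots> \<le> R ^ (2 * m)" by (intro R_power_mono) simp
  finally show ?thesis .
qed

text \<open>With this bound the running sums of \<open>totals\<close> and \<open>scores\<close>
  escape the truncation.\<close>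

lemma sum_le_N:
  assumes "i \<le> R" "\<And>j. j < i \<Longrightarrow> w j \<le> R ^ (2 * m + 1)"
  shows "(\<Sum>j<i. w j) \<le> N"
proof -
  have "(\<Sum>j<i. w j) \<le> i * R ^ (2 * m + 1)"
    using sum_bounded_above[of "{..<i}" w] assms(2) by simp
  also have "\<dots> \<le> R * R ^ (2 * m + 1)" using assms(1) by (rule mult_le_mono1)
  finally show ?thesis by (simp add: N_def)
qed

text \<open>\<open>f v\<close> may exceed \<open>N\<close>, but only the quotient
  \<open>l v\<close>, which is at most \<open>R\<close>, is stored.\<close>

lemma sem_weights:
  assumes s: "ready s" and G: "s 8 0 = G"
  shows "\<forall>v\<in>V. sem weights s 10 v = g v \<and> sem weights s 11 v = l v \<and> sem weights s 12 v = h v \<and>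
    sem weights s 21 v = R ^ m \<and> sem weights s 22 v = R ^ m"
proof -
  let ?P = "\<lambda>s' v. s' 10 v = g v \<and> s' 11 v = l v \<and> s' 12 v = h v \<and>
    s' 21 v = R ^ m \<and> s' 22 v = R ^ m"
  have "\<forall>j<n. ?P (sem weights s) (vs ! j)"
    unfolding weights_def
  proof (rule For_rule[where n = n and I = "\<lambda>i s'. \<forall>j<i. ?P s' (vs ! j)"], goal_cases)
    case (6 i s')
    have rs': "ready s'" using s 6(4) by (simp add: ready_def)
    have G': "s' 8 0 = G" using G 6(4) by simp
    have v: "vs ! i \<in> V" using 6(1) by (rule vs_nth)
    have le: "g (vs ! i) \<le> N" "l (vs ! i) \<le> N" "h (vs ! i) \<le> N" "R ^ m \<le> N"
      using g_le_m[OF v] twice_l_le[OF v] twice_h_le[OF v] R_le_N R_power_le_N[of m]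
      by (auto simp: R_def)
    show ?case
      using 6(1,2,3) le rs' G'
      by (auto simp: store_apply aval_input ready_cells less_Suc_eq l_def[symmetric] h_def[symmetric])
  qed (use s in \<open>auto simp: ready_cells store_apply\<close>)
  then show ?thesis by (auto simp: in_set_conv_nth n_def)
qed

lemma represents_initial:
  assumes s: "ready s" and s1: "s 1 = (\<lambda>_. 0)"
  shows "represents {} (sem weights (sem min_lower s))"
proof -
  have r1: "ready (sem min_lower s)"
    using s by (rule ready_frame) (simp add: min_lower_def)
  have r2: "ready (sem weights (sem min_lower s))"
    using r1 by (rule ready_frame) (simp add: weights_def)
  have "1 \<notin> writes weights" "1 \<notin> writes min_lower"
    by (simp_all add: weights_def min_lower_def)
  then have "sem weights (sem min_lower s) 1 = (\<lambda>_. 0)"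
    using s1 by (simp add: sem_frame)
  moreover have "0 < g v" if "v \<in> V" for v using G_le[OF that] G_pos by simp
  ultimately show ?thesis
    using r2 sem_weights[OF r1 sem_min_lower[OF s]]
    by (simp add: represents_def pn_def qn_def hits_def)
qed

lemma sem_totals:
  assumes s: "represents S s" and S: "S \<subseteq> {..<m}"
  shows "sem totals s 15 0 = sum (pn S) V \<and> sem totals s 16 0 = sum (qn S) V"
proof -
  let ?s = "store (store s 15 0 0) 16 0 0"
  let ?p = "Asg 15 (Num 0) (Add (Var 15) (Cell 21 (vertex 17))) ;;
       Asg 16 (Num 0) (Add (Var 16) (Cell 22 (vertex 17)))"
  have s': "represents S ?s" using s by (rule represents_frame) (auto simp: store_apply)
  have "sem (For 17 3 ?p) ?s 15 0 = (\<Sum>j<n. pn S (vs ! j)) \<and>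
      sem (For 17 3 ?p) ?s 16 0 = (\<Sum>j<n. qn S (vs ! j))"
  proof (rule For_rule[where n = n and I = "\<lambda>i s'. s' 15 0 = (\<Sum>j<i. pn S (vs ! j)) \<and>
      s' 16 0 = (\<Sum>j<i. qn S (vs ! j))"], goal_cases)
    case (6 i s')
    have r: "represents S s'"
      using s' by (rule represents_frame) (use 6(4) in auto)
    then have rs: "ready s'" by (simp add: represents_def)
    have v: "vs ! i \<in> V" using 6(1) by (rule vs_nth)
    have vals: "s' 21 (vs ! i) = pn S (vs ! i)" "s' 22 (vs ! i) = qn S (vs ! i)"
      using r v by (auto simp: represents_def)
    have up: "R ^ (2 * m) \<le> R ^ (2 * m + 1)" by (rule R_power_mono) simp
    have iR: "Suc i \<le> R" using 6(1) by (simp add: R_def)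
    have le: "pn S (vs ! j) \<le> R ^ (2 * m + 1)" "qn S (vs ! j) \<le> R ^ (2 * m + 1)" if "j < Suc i" for j
      using le_trans[OF pn_le[OF vs_nth S] up] le_trans[OF qn_le[OF S] up] that 6(1) by auto
    have "(\<Sum>j<Suc i. pn S (vs ! j)) \<le> N" "(\<Sum>j<Suc i. qn S (vs ! j)) \<le> N"
      by (rule sum_le_N[OF iR], rule le, assumption)+
    then show ?case
      using 6(1,2,3) rs vals by (simp add: store_apply aval_input ready_cells)
  qed (use s in \<open>auto simp: represents_def ready_cells store_apply\<close>)
  moreover have "sem totals s = sem (For 17 3 ?p) ?s"
    by (simp add: totals_def)
  ultimately show ?thesis by (simp add: sum_vertices)
qed

lemma edge_nth:
  assumes "e < m" "i < k"
  shows "es ! e ! i \<in> V" "es ! e ! i \<in> E e"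
proof -
  have "es ! e \<in> set es" using assms(1) by (simp add: m_def)
  then have "length (es ! e) = k" "set (es ! e) \<subseteq> V" using edge by auto
  then show "es ! e ! i \<in> V" "es ! e ! i \<in> E e"
    using assms(2) nth_mem[of i "es ! e"] by (auto simp: E_def)
qed

lemma sem_scores:
  assumes s: "represents S s" and S: "S \<subseteq> {..<m}" and e: "s 14 0 = e" "e < m"
  shows "sem scores s 18 0 = (\<Sum>v\<in>E e. pn S v * l v) \<and>
    sem scores s 19 0 = (\<Sum>v\<in>E e. qn S v * h v)"
proof -
  let ?s = "store (store s 18 0 0) 19 0 0"
  let ?p = "Asg 18 (Num 0) (Add (Var 18) (Mul (Cell 21 member) (Cell 11 member))) ;;
       Asg 19 (Num 0) (Add (Var 19) (Mul (Cell 22 member) (Cell 12 member)))"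
  let ?x = "\<lambda>i. es ! e ! i"
  have s': "represents S ?s" using s by (rule represents_frame) (auto simp: store_apply)
  have kn: "min k n = k" using k_le_n[OF e(2)] by simp
  have "sem (For 20 5 ?p) ?s 18 0 = (\<Sum>j<k. pn S (?x j) * l (?x j)) \<and>
      sem (For 20 5 ?p) ?s 19 0 = (\<Sum>j<k. qn S (?x j) * h (?x j))"
  proof (rule For_rule[where n = k and I = "\<lambda>i s'. s' 18 0 = (\<Sum>j<i. pn S (?x j) * l (?x j)) \<and>
      s' 19 0 = (\<Sum>j<i. qn S (?x j) * h (?x j))"], goal_cases)
    case (6 i s')
    have r: "represents S s'"
      using s' by (rule represents_frame) (use 6(4) in auto)
    then have rs: "ready s'" by (simp add: represents_def)
    have e': "s' 14 0 = e" using 6(4) e by (simp add: store_apply)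
    have vals: "s' 21 (?x i) = pn S (?x i)" "s' 22 (?x i) = qn S (?x i)"
      "s' 11 (?x i) = l (?x i)" "s' 12 (?x i) = h (?x i)"
      using r edge_nth[OF e(2) 6(1)] by (auto simp: represents_def)
    have iR: "Suc i \<le> R" using 6(1) k_le_n[OF e(2)] by (simp add: R_def)
    have le: "pn S (?x j) * l (?x j) \<le> R ^ (2 * m + 1)" "qn S (?x j) * h (?x j) \<le> R ^ (2 * m + 1)"
      if "j < Suc i" for j
    proof -
      have x: "?x j \<in> V" using edge_nth(1)[OF e(2), of j] that 6(1) by simp
      show "pn S (?x j) * l (?x j) \<le> R ^ (2 * m + 1)" "qn S (?x j) * h (?x j) \<le> R ^ (2 * m + 1)"
        unfolding power_add power_one_right
        using pn_le[OF x S] qn_le[OF S] twice_l_le[OF x] twice_h_le[OF x]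
        by (auto intro!: mult_le_mono)
    qed
    have "(\<Sum>j<Suc i. pn S (?x j) * l (?x j)) \<le> N" "(\<Sum>j<Suc i. qn S (?x j) * h (?x j)) \<le> N"
      by (rule sum_le_N[OF iR], rule le, assumption)+
    then show ?case
      using 6(1,2,3) rs vals e' e(2) by (simp add: store_apply aval_member ready_cells)
  qed (use s kn in \<open>auto simp: represents_def ready_cells store_apply\<close>)
  moreover have "sem scores s = sem (For 20 5 ?p) ?s"
    by (simp add: scores_def)
  ultimately show ?thesis
    using sum_members[OF e(2), of "\<lambda>v. pn S v * l v"] sum_members[OF e(2), of "\<lambda>v. qn S v * h v"]
    by (simp add: E_def)
qed

text \<open>\<open>R ^ m\<close> is the common scale: every selected edge at \<open>v\<close> turns
  one of \<open>m\<close> factors \<open>R\<close> into \<open>R + l v\<close>.\<close>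

lemma real_pn:
  assumes "S \<subseteq> {..<m}"
  shows "real (pn S v) = real R ^ m * greedy.p S v"
proof -
  have "real R ^ m = real R ^ (m - hits E S v) * real R ^ hits E S v"
    using hits_le_m[OF assms, of v] by (simp add: power_add[symmetric])
  moreover have "real R ^ hits E S v * (1 + real (l v) / real R) ^ hits E S v = real (R + l v) ^ hits E S v"
    using R_pos by (simp add: power_mult_distrib[symmetric] field_simps)
  ultimately show ?thesis by (simp add: pn_def greedy.p_def)
qed

lemma real_qn:
  assumes "v \<in> V" "S \<subseteq> {..<m}"
  shows "real (qn S v) = real R ^ m * greedy.q S v"
proof -
  have "real R ^ m = real R ^ (m - hits E S v) * real R ^ hits E S v"
    using hits_le_m[OF assms(2), of v] by (simp add: power_add[symmetric])
  moreover have "real R ^ hits E S v * (1 - real (h v) / real R) ^ hits E S v = real (R - h v) ^ hits E S v"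
    using R_pos twice_h_le[OF assms(1)] by (simp add: power_mult_distrib[symmetric] field_simps of_nat_diff)
  ultimately show ?thesis by (simp add: qn_def greedy.q_def)
qed

text \<open>Compared with the real inequality, both sides carry the same positive factor
  \<open>R ^ m * R * R ^ m\<close>, so the integer test is exact.\<close>

lemma cand_iff:
  assumes S: "S \<subseteq> {..<m}" and e: "e < m"
  shows "greedy.cand S e \<longleftrightarrow> e \<notin> S \<and> sum (qn S) V \<noteq> 0 \<and>
    (\<Sum>v\<in>E e. pn S v * l v) * sum (qn S) V \<le> 3 * ((\<Sum>v\<in>E e. qn S v * h v) * sum (pn S) V)"
proof -
  let ?c = "real R ^ m"
  have EV: "v \<in> V" if "v \<in> E e" for v using greedy.E_sub[OF e] that by auto
  have c: "0 < ?c" using R_pos by simp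
  have P: "real (sum (pn S) V) = ?c * sum (greedy.p S) V"
    by (simp add: real_pn[OF S] sum_distrib_left)
  have Q: "real (sum (qn S) V) = ?c * sum (greedy.q S) V"
    by (simp add: real_qn[OF _ S] sum_distrib_left)
  have A: "real (\<Sum>v\<in>E e. pn S v * l v) = ?c * R * (\<Sum>v\<in>E e. greedy.p S v * (real (l v) / real R))"
    using R_pos by (simp add: real_pn[OF S] sum_distrib_left mult.assoc)
  have B: "real (\<Sum>v\<in>E e. qn S v * h v) = ?c * R * (\<Sum>v\<in>E e. greedy.q S v * (real (h v) / real R))"
    using R_pos EV by (simp add: real_qn[OF _ S] sum_distrib_left mult.assoc)
  have "sum (qn S) V = 0 \<longleftrightarrow> real (sum (qn S) V) = 0" by (simp only: of_nat_eq_0_iff)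
  also have "\<dots> \<longleftrightarrow> sum (greedy.q S) V = 0" unfolding Q using R_pos by simp
  finally have Q0: "sum (qn S) V = 0 \<longleftrightarrow> sum (greedy.q S) V = 0" .
  let ?A = "\<Sum>v\<in>E e. greedy.p S v * (real (l v) / real R)"
    and ?B = "\<Sum>v\<in>E e. greedy.q S v * (real (h v) / real R)"
    and ?P = "sum (greedy.p S) V" and ?Q = "sum (greedy.q S) V"
  have "(\<Sum>v\<in>E e. pn S v * l v) * sum (qn S) V \<le> 3 * ((\<Sum>v\<in>E e. qn S v * h v) * sum (pn S) V) \<longleftrightarrow>
    real (\<Sum>v\<in>E e. pn S v * l v) * real (sum (qn S) V)
      \<le> 3 * (real (\<Sum>v\<in>E e. qn S v * h v) * real (sum (pn S) V))"
    by (simp only: of_nat_mult[symmetric] of_nat_numeral[symmetric, where 'a = real] of_nat_le_iff)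
  also have "\<dots> \<longleftrightarrow> (?c * R * ?c) * (?A * ?Q) \<le> (?c * R * ?c) * (3 * ?B * ?P)"
    unfolding A B P Q by (simp only: ac_simps)
  also have "\<dots> \<longleftrightarrow> ?A * ?Q \<le> 3 * ?B * ?P"
    using c R_pos by (intro mult_le_cancel_left_pos) simp
  finally show ?thesis
    unfolding greedy.cand_def Q0 by simp
qed

lemma aval_test:
  assumes s: "represents S s" and S: "S \<subseteq> {..<m}" and e: "s 14 0 = e" "e < m"
    and tot: "s 15 0 = sum (pn S) V" "s 16 0 = sum (qn S) V"
    and sc: "s 18 0 = (\<Sum>v\<in>E e. pn S v * l v)" "s 19 0 = (\<Sum>v\<in>E e. qn S v * h v)"
  shows "aval test s \<noteq> 0 \<longleftrightarrow> greedy.cand S e"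
proof -
  have "s 1 e = of_bool (e \<in> S)" using s e by (simp add: represents_def)
  then show ?thesis
    unfolding cand_iff[OF S e(2)] using e(1)
    by (simp add: test_def tot sc del: sum_eq_0_iff) auto
qed

text \<open>As \<open>e\<close> is not yet selected, the degree of \<open>v\<close> in
  \<open>S\<close> is below \<open>m\<close>. So \<open>pn S v\<close> still has a factor
  \<open>R\<close> and the division is exact.\<close>

lemma pn_insert:
  assumes "e < m" "e \<notin> S" "v \<in> E e" "S \<subseteq> {..<m}"
  shows "pn (insert e S) v = pn S v div R * (R + l v)"
proof -
  have fin: "finite S" using assms(4) finite_subset by blast
  have "hits E (insert e S) v = Suc (hits E S v)"
    using hits_insert[OF fin assms(2), of E v] assms(3) by simp
  moreover have "hits E (insert e S) v \<le> m" using assms by (intro hits_le_m) auto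
  ultimately show ?thesis
    using R_pos by (simp add: pn_def Suc_diff_Suc[of "hits E S v" m, symmetric] mult.assoc)
qed

text \<open>Exact division as in \<open>pn_insert\<close>; the leading factor is the indicator that
  demand remains after \<open>e\<close> is added.\<close>

lemma qn_insert:
  assumes "e < m" "e \<notin> S" "v \<in> E e" "S \<subseteq> {..<m}"
  shows "qn (insert e S) v = (1 - (1 - (g v - 40 * hits E (insert e S) v))) * (qn S v div R * (R - h v))"
proof -
  have fin: "finite S" using assms(4) finite_subset by blast
  have "hits E (insert e S) v = Suc (hits E S v)"
    using hits_insert[OF fin assms(2), of E v] assms(3) by simp
  moreover have "hits E (insert e S) v \<le> m" using assms by (intro hits_le_m) auto
  ultimately show ?thesis
    using R_pos by (simp add: qn_def Suc_diff_Suc[of "hits E S v" m, symmetric] mult.assoc)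
qed

lemma represents_advance:
  assumes s: "represents S s" and S: "S \<subseteq> {..<m}" and e: "s 14 0 = e" "e < m" "e \<notin> S"
  shows "represents (insert e S) (sem advance s)"
proof -
  let ?S = "insert e S"
  let ?s = "store s 1 e 1"
  let ?x = "\<lambda>i. es ! e ! i"
  let ?p = "Asg 10 member (Sub (Cell 10 member) (Num 40)) ;;
       Asg 21 member (Mul (Quot (Cell 21 member) (Var 6)) (Add (Var 6) (Cell 11 member))) ;;
       Asg 22 member (Mul (Sub (Num 1) (Sub (Num 1) (Cell 10 member)))
         (Mul (Quot (Cell 22 member) (Var 6)) (Sub (Var 6) (Cell 12 member))))"
  \<comment> \<open>After \<open>i\<close> rounds exactly the first \<open>i\<close> vertices of the
    edge carry the values for \<open>?S\<close>, all others still those for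
    \<open>S\<close>.\<close>
  define T where "T i v = (if v \<in> set (take i (es ! e)) then ?S else S)" for i v
  let ?I = "\<lambda>i s'. \<forall>v\<in>V. s' 10 v = g v - 40 * hits E (T i v) v \<and> s' 21 v = pn (T i v) v \<and>
    s' 22 v = qn (T i v) v"
  have fin: "finite S" using S finite_subset by blast
  have ee: "distinct (es ! e)" "length (es ! e) = k"
    using edge[of "es ! e"] e(2) by (auto simp: m_def)
  have kn: "min k n = k" using k_le_n[OF e(2)] by simp
  have rs: "ready s" using s by (simp add: represents_def)
  then have rs': "ready ?s" by simp
  have N1: "1 \<le> N" using R_le_N R_ge_2 by linarith
  have SS: "?S \<subseteq> {..<m}" using S e by auto
  have "?I k (sem (For 20 5 ?p) ?s)"
  proof (rule For_rule[where n = k and I = ?I], goal_cases)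
    case (6 i s')
    have r: "ready s'" using rs' 6(4) by (simp add: ready_def)
    have e': "s' 14 0 = e" using 6(4) e by (simp add: store_apply)
    have x: "?x i \<in> V" "?x i \<in> E e" using edge_nth[OF e(2) 6(1)] by auto
    have "?x i \<notin> set (take i (es ! e))"
      using ee 6(1) by (auto simp: in_set_conv_nth nth_eq_iff_index_eq)
    then have Ti: "T i (?x i) = S" by (simp add: T_def)
    have TS: "T (Suc i) v = (if v = ?x i then ?S else T i v)" for v
      using ee 6(1) by (auto simp: T_def take_Suc_conv_app_nth)
    have lh: "s' 11 (?x i) = l (?x i)" "s' 12 (?x i) = h (?x i)"
      using s x 6(4) by (auto simp: represents_def store_apply)
    have "hits E ?S (?x i) = hits E S (?x i) + 1"
      using hits_insert[OF fin e(3), of E "?x i"] x(2) by simp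
    then have need: "s' 10 (?x i) - 40 = g (?x i) - 40 * hits E ?S (?x i)"
      using 6(2) x(1) Ti by simp
    have old: "s' 21 (?x i) = pn S (?x i)"
      "s' 22 (?x i) = qn S (?x i)"
      using 6(2) x(1) Ti by auto
    have bounds: "g (?x i) - 40 * hits E ?S (?x i) \<le> N" "pn ?S (?x i) \<le> N" "qn ?S (?x i) \<le> N"
      using g_le_m[OF x(1)] R_le_N pn_le[OF x(1) SS] qn_le[OF SS, of "?x i"] R_power_le_N[of "2 * m"]
      by (auto simp: R_def)
    define x where "x = ?x i"
    \<comment> \<open>First the values as assigned, with truncation; \<open>bounds\<close> then
      removes each \<open>min\<close>.\<close>
    have "sem ?p s' 10 = (s' 10)(x := min (s' 10 x - 40) N)"
      "sem ?p s' 21 = (s' 21)(x := min (s' 21 x div R * (R + s' 11 x)) N)"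
      "sem ?p s' 22 = (s' 22)(x := min ((1 - (1 - min (s' 10 x - 40) N)) *
        (s' 22 x div R * (R - s' 12 x))) N)"
      using 6(1,3) e' e(2) r by (simp_all add: store_apply aval_member ready_cells x_def)
    then have upd: "sem ?p s' 10 = (s' 10)(?x i := g (?x i) - 40 * hits E ?S (?x i))"
      "sem ?p s' 21 = (s' 21)(?x i := pn ?S (?x i))"
      "sem ?p s' 22 = (s' 22)(?x i := qn ?S (?x i))"
      using bounds
      by (simp_all only: x_def need lh old pn_insert[OF e(2,3) x(2) S, symmetric] min_absorb1
          qn_insert[OF e(2,3) x(2) S, symmetric])
    have "?I (Suc i) (store t 20 0 (Suc i))"
      if "t 10 = (s' 10)(?x i := g (?x i) - 40 * hits E ?S (?x i))"
        "t 21 = (s' 21)(?x i := pn ?S (?x i))" "t 22 = (s' 22)(?x i := qn ?S (?x i))" for t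
      using that 6(2) by (simp add: TS store_apply)
    then show ?case using upd by blast
  qed (use s kn rs in \<open>auto simp: represents_def ready_cells store_apply T_def\<close>)
  moreover have "sem advance s = sem (For 20 5 ?p) ?s"
    using rs e N1 by (simp add: advance_def ready_cells)
  ultimately have I: "?I k (sem advance s)" by simp
  \<comment> \<open>Off the edge \<open>e\<close> the degrees in \<open>S\<close> and
    \<open>?S\<close> agree, so \<open>T k v\<close> may be replaced by \<open>?S\<close>
    everywhere.\<close>
  have unchanged: "hits E (T k v) v = hits E ?S v" for v
    using ee hits_insert[OF fin e(3), of E v] by (auto simp: T_def E_def)
  have fr: "sem advance s z = s z" if "z \<notin> {1, 10, 20, 21, 22}" for z
    using that by (intro sem_frame) (simp add: advance_def)
  have "sem (For 20 5 ?p) ?s 1 = ?s 1" by (intro sem_frame) simp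
  then have one: "sem advance s 1 = (s 1)(e := 1)"
    using \<open>sem advance s = sem (For 20 5 ?p) ?s\<close> by (simp add: store_apply)
  show ?thesis
    using s I fr one e(2) by (auto simp: represents_def ready_def unchanged pn_def qn_def)
qed

lemma represents_try_edge:
  assumes s: "represents S s" and S: "S \<subseteq> {..<m}" and e: "s 14 0 = e" "e < m"
  shows "represents (greedy.add_edge S e) (sem try_edge s)"
proof -
  let ?s1 = "sem totals s" and ?s2 = "sem scores (sem totals s)"
  have fr1: "?s1 z = s z" if "z \<notin> {15, 16, 17}" for z
    using that by (intro sem_frame) (simp add: totals_def)
  have fr2: "?s2 z = ?s1 z" if "z \<notin> {18, 19, 20}" for z
    using that by (intro sem_frame) (simp add: scores_def)
  have r1: "represents S ?s1" using s by (rule represents_frame) (auto simp: fr1)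
  have r2: "represents S ?s2" using r1 by (rule represents_frame) (auto simp: fr2)
  have e1: "?s1 14 0 = e" and e2: "?s2 14 0 = e" using e by (simp_all add: fr1 fr2)
  have "aval test ?s2 \<noteq> 0 \<longleftrightarrow> greedy.cand S e"
    using sem_totals[OF s S] sem_scores[OF r1 S e1 e(2)]
    by (intro aval_test r2 S e2 e(2)) (simp_all add: fr2)
  then show ?thesis
    using represents_advance[OF r2 S e2 e(2)] r2
    by (auto simp: try_edge_def greedy.add_edge_def greedy.cand_def)
qed

lemma writes_try_edge: "writes try_edge = {1, 10, 15, 16, 17, 18, 19, 20, 21, 22}"
  by (auto simp: try_edge_def totals_def scores_def advance_def)

lemma represents_pass:
  assumes s: "represents S s" and S: "S \<subseteq> {..<m}"
  shows "represents (greedy.pass S) (sem (For 14 4 try_edge) s)"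
  unfolding greedy.pass_def
proof (rule For_rule[where n = m and I = "\<lambda>i. represents (foldl greedy.add_edge S [0..<i])"], goal_cases)
  case (6 i s')
  have "foldl greedy.add_edge S [0..<i] \<subseteq> {..<m}"
    using greedy.foldl_subset[OF S, of "[0..<i]"] 6(1) by (simp add: atLeast0LessThan)
  from represents_try_edge[OF 6(2) this 6(3) 6(1)]
  have "represents (foldl greedy.add_edge S [0..<Suc i]) (sem try_edge s')" by simp
  then show ?case by (rule represents_frame) (auto simp: store_apply)
next
  case 5
  show ?case using s by (auto intro: represents_frame simp: store_apply)
qed (use s in \<open>auto simp: writes_try_edge represents_def ready_cells\<close>)

lemma represents_main:
  assumes s: "ready s" "s 1 = (\<lambda>_. 0)"
  shows "represents ((greedy.pass ^^ m) {}) (sem main s)"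
proof -
  let ?s = "sem weights (sem min_lower s)"
  have r: "represents {} ?s" using s by (rule represents_initial)
  have "represents ((greedy.pass ^^ m) {}) (sem (For 13 4 (For 14 4 try_edge)) ?s)"
  proof (rule For_rule[where n = m and I = "\<lambda>i. represents ((greedy.pass ^^ i) {})"], goal_cases)
    case (6 i s')
    have "(greedy.pass ^^ i) {} \<subseteq> {..<m}"
      using greedy.good_passes[of i] by (simp add: greedy.good_def)
    from represents_pass[OF 6(2) this]
    have "represents ((greedy.pass ^^ Suc i) {}) (sem (For 14 4 try_edge) s')" by simp
    then show ?case by (rule represents_frame) (auto simp: store_apply)
  next
    case 5
    show ?case using r by (auto intro: represents_frame simp: store_apply)
  qed (use r in \<open>auto simp: writes_try_edge represents_def ready_cells\<close>)
  then show ?thesis by (simp add: main_def)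
qed

end

section \<open>From edge indices back to hypergraphs, and the conclusion\<close>

lemma degree_in_image:
  assumes "distinct (map set es)" "S \<subseteq> {..<length es}"
  shows "degree_in ((\<lambda>j. set (es ! j)) ` S) v = hits (\<lambda>j. set (es ! j)) S v"
proof -
  have "inj_on (\<lambda>j. set (es ! j)) {..<length es}"
    using assms(1) by (auto simp: inj_on_def distinct_conv_nth)
  then have "inj_on (\<lambda>j. set (es ! j)) {j \<in> S. v \<in> set (es ! j)}"
    by (rule inj_on_subset) (use assms(2) in auto)
  moreover have "{e \<in> (\<lambda>j. set (es ! j)) ` S. v \<in> e} = (\<lambda>j. set (es ! j)) ` {j \<in> S. v \<in> set (es ! j)}"
    by auto
  ultimately show ?thesis by (simp add: degree_in_def hits_def card_image)
qed

lemma card_edge: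
  assumes "uniform_partite k V F" "e \<in> F"
  shows "card e = k"
proof -
  obtain P :: "nat \<Rightarrow> 'a set" where P: "disjoint_family_on P {1..k}" "(\<Union>i\<in>{1..k}. P i) = V"
    and one: "\<forall>e\<in>F. \<forall>i\<in>{1..k}. card (e \<inter> P i) = 1"
    using assms(1) by (auto simp: uniform_partite_def)
  have e: "e \<subseteq> V" "finite e"
    using assms by (auto simp: uniform_partite_def intro: finite_subset)
  then have "card e = card (\<Union>i\<in>{1..k}. e \<inter> P i)"
    using P(2) by (intro arg_cong[where f = card]) blast
  also have "\<dots> = (\<Sum>i\<in>{1..k}. card (e \<inter> P i))"
    using P(1) e(2) by (intro card_UN_disjoint) (auto simp: disjoint_family_on_def)
  also have "\<dots> = k" using one assms(2) by simp
  finally show ?thesis .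
qed

lemma graph_inputI:
  assumes "2 \<le> k" "uniform_partite k V F" "lists_hypergraph vs es V F"
  shows "graph_input k vs es"
proof
  show "distinct vs" "0 < k" using assms by (auto simp: lists_hypergraph_def)
  fix e assume e: "e \<in> set es"
  have d: "distinct e" and F: "set e \<in> F" and V: "set vs = V"
    using assms(3) e by (auto simp: lists_hypergraph_def)
  moreover have "length e = k"
    using card_edge[OF assms(2) F] d by (simp add: distinct_card)
  ultimately show "distinct e \<and> set e \<subseteq> set vs \<and> length e = k"
    using assms(2) by (auto simp: uniform_partite_def)
qed

lemma algorithm_poly_time: "poly_time_on instances algorithm"
  unfolding poly_time_on_def
proof (rule exI[of _ time_bound], rule ballI)
  fix xs assume "xs \<in> instances"
  then obtain k vs es g f V F where xs: "xs = encode k vs es g f"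
    and inst: "2 \<le> k" "uniform_partite k V F" "lists_hypergraph vs es V F"
    by (auto simp: instances_def)
  interpret graph_input k vs es g f by (rule graph_inputI[OF inst])
  have "\<exists>s. runs algorithm (init xs) s (poly time_bound (input_size xs))"
    using algorithm_runs unfolding input_def xs by blast
  then obtain s t where "t \<le> poly time_bound (input_size xs)"
    "exec algorithm (init xs) (return_pmf (s, t))"
    unfolding runs_def by blast
  then show "\<exists>D. exec algorithm (init xs) D \<and>
      (\<forall>(s, t)\<in>set_pmf D. t \<le> poly time_bound (input_size xs))"
    by (intro exI[of _ "return_pmf (s, t)"]) simp
qed

theorem theorem44:
  "\<exists>\<alpha>::real. \<alpha> > 0 \<and> (\<exists>A::com. poly_time_on instances A \<and>
     (\<forall>(k::nat) (V::nat set) (F::nat set set) (g::nat \<Rightarrow> nat) (f::nat \<Rightarrow> nat)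
        (vs::nat list) (es::nat list list).
        2 \<le> k \<longrightarrow> uniform_partite k V F \<longrightarrow> lists_hypergraph vs es V F \<longrightarrow>
        (\<forall>v\<in>V. \<alpha> * real k ^ 3 * ln (real (card V)) \<le> real (g v) \<and> g v \<le> f v) \<longrightarrow>
        (\<exists>F''. F'' \<subseteq> F \<and> (\<forall>v\<in>V. g v \<le> degree_in F'' v \<and> degree_in F'' v \<le> f v)) \<longrightarrow>
        (\<exists>D. exec A (init (encode k vs es g f)) D \<and>
           (\<forall>(s, t)\<in>set_pmf D. selected es s \<subseteq> F) \<and>
           measure_pmf.prob D {(s, t).
             \<forall>v\<in>V. real (g v) / (20 * real k) \<le> real (degree_in (selected es s) v) \<and>
                   degree_in (selected es s) v \<le> f v}
           \<ge> 1 - 4 / real (card V) ^ 4)))"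
proof (rule exI[of _ 11], intro conjI exI[of _ algorithm] algorithm_poly_time allI impI)
  fix k :: nat and V :: "nat set" and F :: "nat set set" and g f :: "nat \<Rightarrow> nat"
    and vs :: "nat list" and es :: "nat list list"
  assume k: "2 \<le> k" and part: "uniform_partite k V F" and lists: "lists_hypergraph vs es V F"
    and bounds: "\<forall>v\<in>V. 11 * real k ^ 3 * ln (real (card V)) \<le> real (g v) \<and> g v \<le> f v"
    and feasible: "\<exists>F''. F'' \<subseteq> F \<and> (\<forall>v\<in>V. g v \<le> degree_in F'' v \<and> degree_in F'' v \<le> f v)"
  interpret graph_input k vs es g f by (rule graph_inputI[OF k part lists])
  have V: "set vs = V" and F: "set ` set es = F" and dist: "distinct (map set es)"
    using lists by (auto simp: lists_hypergraph_def)
  obtain s0 where s0: "ready s0" "s0 1 = (\<lambda>_. 0)"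
    and run: "runs algorithm (init input) (sem main s0) (poly time_bound (input_size input))"
    using algorithm_runs by blast
  define s where "s = sem main s0"
  obtain t where exec: "exec algorithm (init (encode k vs es g f)) (return_pmf (s, t))"
    using run unfolding runs_def input_def s_def by blast
  let ?good = "{(s, t :: nat). \<forall>v\<in>V. real (g v) / (20 * real k) \<le> real (degree_in (selected es s) v) \<and>
      degree_in (selected es s) v \<le> f v}"
  have sel: "selected es s' \<subseteq> F" for s'
    unfolding selected_def F[symmetric] by auto
  have "1 - 4 / real (card V) ^ 4 \<le> measure_pmf.prob (return_pmf (s, t)) ?good"
  proof (cases "card V = 1")
    \<comment> \<open>For a single vertex the logarithm is 0 and \<open>g\<close> may vanish, but
      the required probability \<open>1 - 4\<close> is negative.\<close>
    case True
    show ?thesis by (rule order_trans[OF _ measure_nonneg]) (simp add: True)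
  next
    case False
    have "(s, t) \<in> ?good"
    \<comment> \<open>For empty \<open>V\<close> division by zero makes the required probability 1,
      and the degree condition is vacuous.\<close>
    proof (cases "V = {}")
      case nonempty: False
      have "card V \<noteq> 0" using V nonempty by auto
      then have c2: "2 \<le> card V" using False by linarith
      then have ln_pos: "0 < ln (real (card V))" by simp
      \<comment> \<open>The constant 11 comes from \<open>k ^ 3 \<ge> 8\<close>: 8 * 11 = 88 is
        above 80, strictly enough for \<open>G_large\<close> since
        \<open>ln (card V) > 0\<close>.\<close>
      have "(2::real) ^ 3 \<le> real k ^ 3" using k by (intro power_mono) auto
      then have "8 * (11 * ln (real (card V))) \<le> real k ^ 3 * (11 * ln (real (card V)))"
        using ln_pos by (intro mult_right_mono) auto
      then have large: "88 * ln (real (card V)) \<le> real (g v)" if "v \<in> V" for v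
        using bounds that by (force simp: ac_simps)
      obtain F'' where F'': "F'' \<subseteq> F"
        and deg: "\<forall>v\<in>V. g v \<le> degree_in F'' v \<and> degree_in F'' v \<le> f v"
        using feasible by blast
      define J where "J = {j. j < length es \<and> set (es ! j) \<in> F''}"
      have "F'' = (\<lambda>j. set (es ! j)) ` J"
        using F'' unfolding F[symmetric] J_def by (force simp: in_set_conv_nth)
      then have J: "degree_in F'' v = hits (\<lambda>j. set (es ! j)) J v" for v
        using degree_in_image[OF dist, of J v] by (auto simp: J_def)
      define G where "G = Min (g ` set vs)"
      have "G \<in> g ` set vs" unfolding G_def using nonempty V by (intro Min_in) auto
      then have G: "88 * ln (real (card V)) \<le> real G" using large V by auto
      interpret feasible_input k vs es g f J G
        using nonempty V G ln_pos bounds deg J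
        by unfold_locales (auto simp: G_def J_def)
      let ?S = "(greedy.pass ^^ m) {}"
      have S: "?S \<subseteq> {..<m}" using greedy.good_passes[of m] by (simp add: greedy.good_def)
      have "s 1 e = of_bool (e \<in> ?S)" if "e < m" for e
        using represents_main[OF s0] that by (simp add: represents_def s_def)
      with S have "{j. j < m \<and> s 1 j \<noteq> 0} = ?S" by auto
      then have "selected es s = (\<lambda>j. set (es ! j)) ` ?S"
        unfolding selected_def m_def[symmetric] setcompr_eq_image by (rule arg_cong)
      then have d: "degree_in (selected es s) v = hits E ?S v" for v
        using degree_in_image[OF dist, of ?S v] S by (simp add: E_def[abs_def] m_def)
      show ?thesis
      proof (clarsimp simp: d)
        fix v assume v: "v \<in> V"
        have "g v \<le> 40 * hits E ?S v" using greedy.passes_saturate v V by blast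
        \<comment> \<open>The saturation threshold 1/40 is enough because
          \<open>k \<ge> 2\<close>.\<close>
        also have "\<dots> \<le> 20 * k * hits E ?S v" using k by (intro mult_right_mono) auto
        finally have "real (g v) \<le> real (20 * k * hits E ?S v)" by (rule of_nat_mono)
        then show "real (g v) / (20 * real k) \<le> real (hits E ?S v) \<and> hits E ?S v \<le> f v"
          using greedy.passes_upper[of v] v V k by (simp add: field_simps)
      qed
    qed simp
    then show ?thesis by simp
  qed
  with exec sel show "\<exists>D. exec algorithm (init (encode k vs es g f)) D \<and>
      (\<forall>(s, t)\<in>set_pmf D. selected es s \<subseteq> F) \<and>
      measure_pmf.prob D ?good \<ge> 1 - 4 / real (card V) ^ 4"
    by (intro exI[of _ "return_pmf (s, t)"]) auto
qed simp

end
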